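(* Let $\mathbf{k}$ be a field and let $(A_1,\cdot_1,\circ_1)$ and $(A_2,\cdot_2,\circ_2)$ be Jacobi Novikov-Poisson algebras over $\mathbf{k}$. Define two binary operations $\cdot$ and $\circ$ on $A_1\otimes A_2$ by $$(a_1\otimes a_2)\cdot(b_1\otimes b_2)=a_1\cdot_1 b_1\otimes a_2\cdot_2 b_2,$$ $$(a_1\otimes a_2)\circ(b_1\otimes b_2)=a_1\circ_1 b_1\otimes a_2\cdot_2 b_2+a_1\cdot_1 b_1\otimes a_2\circ_2 b_2$$ for all $a_1,b_1\in A_1$, $a_2,b_2\in A_2$. Then $(A_1\otimes A_2,\cdot,\circ)$ is a Jacobi Novikov-Poisson algebra with identity element $1_{A_1}\otimes 1_{A_2}$.
   Context: All vector spaces, algebras and tensor products are over $\mathbf{k}$; binary operations are bilinear. A Novikov algebra $(A,\circ)$ is a vector space with a binary operation satisfying $(a\circ b)\circ c-a\circ(b\circ c)=(b\circ a)\circ c-b\circ(a\circ c)$ and $(a\circ b)\circ c=(a\circ c)\circ b$ for all $a,b,c\in A$. A Jacobi Novikov-Poisson algebra is a triple $(A,\cdot,\circ)$ where $(A,\cdot)$ is a unital commutative associative algebra with identity $1_A$, $(A,\circ)$ is a Novikov algebra, and for all $a,b,c\in A$: $(a\cdot b)\circ c=a\cdot(b\circ c)$ and $c\circ(a\cdot b)=(c\circ a)\cdot b+a\cdot(c\circ b)-a\cdot b\cdot(c\circ 1_A)$. *)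

theory Defs
  imports "HOL-Algebra.AbelCoset" "HOL-Algebra.Module"
begin

section \<open>Bilinear operations on a module\<close>

definition bilinear_op ::
  "('k, 'm) ring_scheme \<Rightarrow> ('k, 'a, 'n) module_scheme \<Rightarrow> ('a \<Rightarrow> 'a \<Rightarrow> 'a) \<Rightarrow> bool" where
  "bilinear_op K V f \<longleftrightarrow>
     (\<forall>x \<in> carrier V. \<forall>y \<in> carrier V. f x y \<in> carrier V) \<and>
     (\<forall>x \<in> carrier V. \<forall>y \<in> carrier V. \<forall>z \<in> carrier V.
        f (x \<oplus>\<^bsub>V\<^esub> y) z = f x z \<oplus>\<^bsub>V\<^esub> f y z \<and> f x (y \<oplus>\<^bsub>V\<^esub> z) = f x y \<oplus>\<^bsub>V\<^esub> f x z) \<and>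
     (\<forall>r \<in> carrier K. \<forall>x \<in> carrier V. \<forall>y \<in> carrier V.
        f (r \<odot>\<^bsub>V\<^esub> x) y = r \<odot>\<^bsub>V\<^esub> f x y \<and> f x (r \<odot>\<^bsub>V\<^esub> y) = r \<odot>\<^bsub>V\<^esub> f x y)"

section \<open>Novikov and Jacobi Novikov-Poisson algebras\<close>

text \<open>The fields \<open>mult\<close> and \<open>one\<close> inherited from the record type \<open>module\<close> hold the commutative
  associative product and its identity; they are irrelevant for a Novikov algebra.\<close>

record ('k, 'a) circ_module = "('k, 'a) module" +
  circ :: "'a \<Rightarrow> 'a \<Rightarrow> 'a" (infixl \<open>\<circ>\<index>\<close> 70)

locale novikov_algebra = K?: field K + A?: module K A
  for K :: "('k, 'm) ring_scheme" (structure) and A :: "('k, 'a, 'n) circ_module_scheme" (structure) +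
  assumes circ_bilinear: "bilinear_op K A (circ A)"
    and left_symmetric: "\<lbrakk>a \<in> carrier A; b \<in> carrier A; c \<in> carrier A\<rbrakk> \<Longrightarrow>
      ((a \<circ>\<^bsub>A\<^esub> b) \<circ>\<^bsub>A\<^esub> c) \<ominus>\<^bsub>A\<^esub> (a \<circ>\<^bsub>A\<^esub> (b \<circ>\<^bsub>A\<^esub> c))
        = ((b \<circ>\<^bsub>A\<^esub> a) \<circ>\<^bsub>A\<^esub> c) \<ominus>\<^bsub>A\<^esub> (b \<circ>\<^bsub>A\<^esub> (a \<circ>\<^bsub>A\<^esub> c))"
    and right_commutative: "\<lbrakk>a \<in> carrier A; b \<in> carrier A; c \<in> carrier A\<rbrakk> \<Longrightarrow>
      (a \<circ>\<^bsub>A\<^esub> b) \<circ>\<^bsub>A\<^esub> c = (a \<circ>\<^bsub>A\<^esub> c) \<circ>\<^bsub>A\<^esub> b"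

locale jacobi_novikov_poisson_algebra = novikov_algebra K A + A?: algebra K A
  for K :: "('k, 'm) ring_scheme" (structure) and A :: "('k, 'a, 'n) circ_module_scheme" (structure) +
  assumes mult_circ: "\<lbrakk>a \<in> carrier A; b \<in> carrier A; c \<in> carrier A\<rbrakk> \<Longrightarrow>
      (a \<otimes>\<^bsub>A\<^esub> b) \<circ>\<^bsub>A\<^esub> c = a \<otimes>\<^bsub>A\<^esub> (b \<circ>\<^bsub>A\<^esub> c)"
    and circ_mult: "\<lbrakk>a \<in> carrier A; b \<in> carrier A; c \<in> carrier A\<rbrakk> \<Longrightarrow>
      c \<circ>\<^bsub>A\<^esub> (a \<otimes>\<^bsub>A\<^esub> b)
        = (((c \<circ>\<^bsub>A\<^esub> a) \<otimes>\<^bsub>A\<^esub> b) \<oplus>\<^bsub>A\<^esub> (a \<otimes>\<^bsub>A\<^esub> (c \<circ>\<^bsub>A\<^esub> b)))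
            \<ominus>\<^bsub>A\<^esub> ((a \<otimes>\<^bsub>A\<^esub> b) \<otimes>\<^bsub>A\<^esub> (c \<circ>\<^bsub>A\<^esub> \<one>\<^bsub>A\<^esub>))"

section \<open>Tensor products of modules\<close>

text \<open>The tensor product is the free module on the product of the two carriers, modulo the
  submodule generated by the bilinearity relations.  Its elements are cosets.  The modules
  built here carry no multiplication, so the record fields \<open>mult\<close> and \<open>one\<close> are \<open>undefined\<close>.\<close>

definition free_module :: "('k, 'm) ring_scheme \<Rightarrow> 's set \<Rightarrow> ('k, 's \<Rightarrow> 'k) module" where
  "free_module K S =
     \<lparr>carrier = {f. (\<forall>s. f s \<in> carrier K) \<and> (\<forall>s. s \<notin> S \<longrightarrow> f s = \<zero>\<^bsub>K\<^esub>) \<and> finite {s. f s \<noteq> \<zero>\<^bsub>K\<^esub>}},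
      mult = undefined, one = undefined,
      zero = (\<lambda>s. \<zero>\<^bsub>K\<^esub>), add = (\<lambda>f g s. f s \<oplus>\<^bsub>K\<^esub> g s),
      smult = (\<lambda>r f s. r \<otimes>\<^bsub>K\<^esub> f s)\<rparr>"

definition basis_elt :: "('k, 'm) ring_scheme \<Rightarrow> 's \<Rightarrow> 's \<Rightarrow> 'k" where
  "basis_elt K s = (\<lambda>t. if t = s then \<one>\<^bsub>K\<^esub> else \<zero>\<^bsub>K\<^esub>)"

definition generated_submodule ::
  "('k, 'm) ring_scheme \<Rightarrow> ('k, 'a, 'n) module_scheme \<Rightarrow> 'a set \<Rightarrow> 'a set" where
  "generated_submodule K M S = \<Inter>{H. submodule H K M \<and> S \<subseteq> H}"

definition quotient_module ::
  "('k, 'a, 'n) module_scheme \<Rightarrow> 'a set \<Rightarrow> ('k, 'a set) module" where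
  "quotient_module M N =
     \<lparr>carrier = a_rcosets\<^bsub>M\<^esub> N, mult = undefined, one = undefined,
      zero = N, add = set_add M,
      smult = (\<lambda>r X. \<Union>x\<in>X. N +>\<^bsub>M\<^esub> (r \<odot>\<^bsub>M\<^esub> x))\<rparr>"

definition tensor_relations ::
  "('k, 'm) ring_scheme \<Rightarrow> ('k, 'a, 'p) module_scheme \<Rightarrow> ('k, 'b, 'q) module_scheme
     \<Rightarrow> ('a \<times> 'b \<Rightarrow> 'k) set" where
  "tensor_relations K V W =
     (let F = free_module K (carrier V \<times> carrier W); e = (\<lambda>v w. basis_elt K (v, w)) in
        {e (v \<oplus>\<^bsub>V\<^esub> v') w \<ominus>\<^bsub>F\<^esub> (e v w \<oplus>\<^bsub>F\<^esub> e v' w) | v v' w.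
           v \<in> carrier V \<and> v' \<in> carrier V \<and> w \<in> carrier W} \<union>
        {e v (w \<oplus>\<^bsub>W\<^esub> w') \<ominus>\<^bsub>F\<^esub> (e v w \<oplus>\<^bsub>F\<^esub> e v w') | v w w'.
           v \<in> carrier V \<and> w \<in> carrier W \<and> w' \<in> carrier W} \<union>
        {e (r \<odot>\<^bsub>V\<^esub> v) w \<ominus>\<^bsub>F\<^esub> (r \<odot>\<^bsub>F\<^esub> e v w) | r v w.
           r \<in> carrier K \<and> v \<in> carrier V \<and> w \<in> carrier W} \<union>
        {e v (r \<odot>\<^bsub>W\<^esub> w) \<ominus>\<^bsub>F\<^esub> (r \<odot>\<^bsub>F\<^esub> e v w) | r v w.
           r \<in> carrier K \<and> v \<in> carrier V \<and> w \<in> carrier W})"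

definition tensor_null ::
  "('k, 'm) ring_scheme \<Rightarrow> ('k, 'a, 'p) module_scheme \<Rightarrow> ('k, 'b, 'q) module_scheme
     \<Rightarrow> ('a \<times> 'b \<Rightarrow> 'k) set" where
  "tensor_null K V W =
     generated_submodule K (free_module K (carrier V \<times> carrier W)) (tensor_relations K V W)"

definition tensor_module ::
  "('k, 'm) ring_scheme \<Rightarrow> ('k, 'a, 'p) module_scheme \<Rightarrow> ('k, 'b, 'q) module_scheme
     \<Rightarrow> ('k, ('a \<times> 'b \<Rightarrow> 'k) set) module" where
  "tensor_module K V W =
     quotient_module (free_module K (carrier V \<times> carrier W)) (tensor_null K V W)"

definition pure_tensor ::
  "('k, 'm) ring_scheme \<Rightarrow> ('k, 'a, 'p) module_scheme \<Rightarrow> ('k, 'b, 'q) module_scheme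
     \<Rightarrow> 'a \<Rightarrow> 'b \<Rightarrow> ('a \<times> 'b \<Rightarrow> 'k) set" where
  "pure_tensor K V W v w =
     tensor_null K V W +>\<^bsub>free_module K (carrier V \<times> carrier W)\<^esub> basis_elt K (v, w)"

section \<open>The two operations on the tensor product\<close>

text \<open>The operations are prescribed on pure tensors only, and by bilinearity elsewhere on the
  carrier.  Existence and uniqueness of such operations has to be proved.\<close>

definition is_tensor_mult ::
  "('k, 'm) ring_scheme \<Rightarrow> ('k, 'a, 'p) circ_module_scheme \<Rightarrow> ('k, 'b, 'q) circ_module_scheme
     \<Rightarrow> (('a \<times> 'b \<Rightarrow> 'k) set \<Rightarrow> ('a \<times> 'b \<Rightarrow> 'k) set \<Rightarrow> ('a \<times> 'b \<Rightarrow> 'k) set) \<Rightarrow> bool" where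
  "is_tensor_mult K A1 A2 m \<longleftrightarrow>
     bilinear_op K (tensor_module K A1 A2) m \<and>
     (\<forall>a1 \<in> carrier A1. \<forall>b1 \<in> carrier A1. \<forall>a2 \<in> carrier A2. \<forall>b2 \<in> carrier A2.
        m (pure_tensor K A1 A2 a1 a2) (pure_tensor K A1 A2 b1 b2)
          = pure_tensor K A1 A2 (a1 \<otimes>\<^bsub>A1\<^esub> b1) (a2 \<otimes>\<^bsub>A2\<^esub> b2))"

definition is_tensor_circ ::
  "('k, 'm) ring_scheme \<Rightarrow> ('k, 'a, 'p) circ_module_scheme \<Rightarrow> ('k, 'b, 'q) circ_module_scheme
     \<Rightarrow> (('a \<times> 'b \<Rightarrow> 'k) set \<Rightarrow> ('a \<times> 'b \<Rightarrow> 'k) set \<Rightarrow> ('a \<times> 'b \<Rightarrow> 'k) set) \<Rightarrow> bool" where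
  "is_tensor_circ K A1 A2 c \<longleftrightarrow>
     bilinear_op K (tensor_module K A1 A2) c \<and>
     (\<forall>a1 \<in> carrier A1. \<forall>b1 \<in> carrier A1. \<forall>a2 \<in> carrier A2. \<forall>b2 \<in> carrier A2.
        c (pure_tensor K A1 A2 a1 a2) (pure_tensor K A1 A2 b1 b2)
          = pure_tensor K A1 A2 (a1 \<circ>\<^bsub>A1\<^esub> b1) (a2 \<otimes>\<^bsub>A2\<^esub> b2)
              \<oplus>\<^bsub>tensor_module K A1 A2\<^esub> pure_tensor K A1 A2 (a1 \<otimes>\<^bsub>A1\<^esub> b1) (a2 \<circ>\<^bsub>A2\<^esub> b2))"

definition tensor_algebra ::
  "('k, 'm) ring_scheme \<Rightarrow> ('k, 'a, 'p) circ_module_scheme \<Rightarrow> ('k, 'b, 'q) circ_module_scheme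
     \<Rightarrow> (('a \<times> 'b \<Rightarrow> 'k) set \<Rightarrow> ('a \<times> 'b \<Rightarrow> 'k) set \<Rightarrow> ('a \<times> 'b \<Rightarrow> 'k) set)
     \<Rightarrow> (('a \<times> 'b \<Rightarrow> 'k) set \<Rightarrow> ('a \<times> 'b \<Rightarrow> 'k) set \<Rightarrow> ('a \<times> 'b \<Rightarrow> 'k) set)
     \<Rightarrow> ('k, ('a \<times> 'b \<Rightarrow> 'k) set) circ_module" where
  "tensor_algebra K A1 A2 m c =
     \<lparr>carrier = carrier (tensor_module K A1 A2), mult = m,
      one = pure_tensor K A1 A2 \<one>\<^bsub>A1\<^esub> \<one>\<^bsub>A2\<^esub>,
      zero = zero (tensor_module K A1 A2), add = add (tensor_module K A1 A2),
      smult = smult (tensor_module K A1 A2), circ = c\<rparr>"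

end

theory Submission
  imports Defs
begin

text \<open>A Jacobi Novikov-Poisson algebra is nothing but a commutative algebra with a linear map \<open>D\<close>
  satisfying \<open>D(ab) = D(a)b + a D(b) - ab D(1)\<close>.  Indeed, the axiom \<open>(ab) \<circ> c = a(b \<circ> c)\<close> with
  \<open>b = 1\<close> gives \<open>a \<circ> c = a D(c)\<close> for \<open>D = 1 \<circ> _\<close>, and the rule for \<open>1 \<circ> (ab)\<close> is the twisted Leibniz
  rule above.  Conversely, for any such \<open>D\<close> the operation \<open>a \<circ> b = a D(b)\<close> satisfies all the axioms:
  \<open>(a \<circ> b) \<circ> c = a D(b) D(c)\<close> is symmetric in \<open>b\<close> and \<open>c\<close>, and the associator
  \<open>(a \<circ> b) \<circ> c - a \<circ> (b \<circ> c) = ab (D(c) D(1) - D(D(c)))\<close> is symmetric in \<open>a\<close> and \<open>b\<close>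
  (\<open>jacobi_novikov_poisson_algebraI_derivation\<close>).

  On the tensor product the two summands of \<open>\<circ>\<close> say that \<open>x \<circ> y = x D(y)\<close> for
  \<open>D = D\<^sub>1 \<otimes> id + id \<otimes> D\<^sub>2\<close> (\<open>circ_eq_mult_derivation_tensor\<close>), and the twisted Leibniz rule, being
  linear in \<open>D\<close>, holds for each of the two summands of \<open>D\<close> and therefore for \<open>D\<close>
  (\<open>leibniz_tensor\<close>).  So only identities between linear or bilinear maps remain, and these may be
  checked on pure tensors
  (\<open>linear_map_tensor_eq\<close>, \<open>bilinear_map_tensor_eq\<close>), because pure tensors span additively
  (\<open>tensor_induct\<close>).

  The two operations exist by the universal property of the tensor product
  (\<open>linear_map_tensor_lift\<close>, \<open>tensor_lift_pure\<close>), applied once in each argument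
  (\<open>bilinear_map_tensor_exists\<close>); that they are unique is the principle of checking on pure tensors
  once more.\<close>

section \<open>Linear maps\<close>

lemma (in abelian_group) minus_eq_zero_iff:
  assumes "x \<in> carrier G" "y \<in> carrier G"
  shows "x \<ominus> y = \<zero> \<longleftrightarrow> x = y"
  using assms by (metis a_minus_def add.inv_closed add.inv_equality minus_minus r_neg)

definition linear_map ::
  "('k, 'm) ring_scheme \<Rightarrow> ('k, 'a, 'p) module_scheme \<Rightarrow> ('k, 'b, 'q) module_scheme
     \<Rightarrow> ('a \<Rightarrow> 'b) \<Rightarrow> bool" where
  "linear_map K M N h \<longleftrightarrow>
     (\<forall>x \<in> carrier M. h x \<in> carrier N) \<and>
     (\<forall>x \<in> carrier M. \<forall>y \<in> carrier M. h (x \<oplus>\<^bsub>M\<^esub> y) = h x \<oplus>\<^bsub>N\<^esub> h y) \<and>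
     (\<forall>r \<in> carrier K. \<forall>x \<in> carrier M. h (r \<odot>\<^bsub>M\<^esub> x) = r \<odot>\<^bsub>N\<^esub> h x)"

definition bilinear_map ::
  "('k, 'm) ring_scheme \<Rightarrow> ('k, 'a, 'p) module_scheme \<Rightarrow> ('k, 'b, 'q) module_scheme
     \<Rightarrow> ('k, 'c, 'r) module_scheme \<Rightarrow> ('a \<Rightarrow> 'b \<Rightarrow> 'c) \<Rightarrow> bool" where
  "bilinear_map K V W P g \<longleftrightarrow>
     (\<forall>v \<in> carrier V. linear_map K W P (g v)) \<and>
     (\<forall>w \<in> carrier W. linear_map K V P (\<lambda>v. g v w))"

text \<open>Bilinearity as linearity in each argument: identities in several variables can then be proved
  one variable at a time, with the closure properties of linear maps.\<close>

lemma bilinear_op_iff_bilinear_map: "bilinear_op K V f \<longleftrightarrow> bilinear_map K V V V f"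
  unfolding bilinear_op_def bilinear_map_def linear_map_def by blast

lemma linear_mapI:
  assumes "\<And>x. x \<in> carrier M \<Longrightarrow> h x \<in> carrier N"
    and "\<And>x y. \<lbrakk>x \<in> carrier M; y \<in> carrier M\<rbrakk> \<Longrightarrow> h (x \<oplus>\<^bsub>M\<^esub> y) = h x \<oplus>\<^bsub>N\<^esub> h y"
    and "\<And>r x. \<lbrakk>r \<in> carrier K; x \<in> carrier M\<rbrakk> \<Longrightarrow> h (r \<odot>\<^bsub>M\<^esub> x) = r \<odot>\<^bsub>N\<^esub> h x"
  shows "linear_map K M N h"
  using assms unfolding linear_map_def by blast

lemma linear_mapD:
  assumes "linear_map K M N h"
  shows linear_map_closed: "x \<in> carrier M \<Longrightarrow> h x \<in> carrier N"
    and linear_map_add: "\<lbrakk>x \<in> carrier M; y \<in> carrier M\<rbrakk> \<Longrightarrow> h (x \<oplus>\<^bsub>M\<^esub> y) = h x \<oplus>\<^bsub>N\<^esub> h y"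
    and linear_map_smult: "\<lbrakk>r \<in> carrier K; x \<in> carrier M\<rbrakk> \<Longrightarrow> h (r \<odot>\<^bsub>M\<^esub> x) = r \<odot>\<^bsub>N\<^esub> h x"
  using assms unfolding linear_map_def by blast+

lemma bilinear_mapD:
  assumes "bilinear_map K V W P g"
  shows bilinear_map_right: "v \<in> carrier V \<Longrightarrow> linear_map K W P (g v)"
    and bilinear_map_left: "w \<in> carrier W \<Longrightarrow> linear_map K V P (\<lambda>v. g v w)"
  using assms unfolding bilinear_map_def by blast+

lemma bilinear_map_closed:
  "\<lbrakk>bilinear_map K V W P g; v \<in> carrier V; w \<in> carrier W\<rbrakk> \<Longrightarrow> g v w \<in> carrier P"
  by (rule linear_map_closed[OF bilinear_map_right])

lemma linear_map_minus:
  assumes "module K M" "module K N" and h: "linear_map K M N h"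
    and x: "x \<in> carrier M" and y: "y \<in> carrier M"
  shows "h (x \<ominus>\<^bsub>M\<^esub> y) = h x \<ominus>\<^bsub>N\<^esub> h y"
proof -
  interpret M: module K M by fact
  interpret N: module K N by fact
  \<comment> \<open>Homogeneity for the scalar \<open>-1\<close> takes care of the inverse.\<close>
  have "\<ominus>\<^bsub>M\<^esub> y = (\<ominus>\<^bsub>K\<^esub> \<one>\<^bsub>K\<^esub>) \<odot>\<^bsub>M\<^esub> y"
    using y by (simp add: M.smult_l_minus)
  then have "h (\<ominus>\<^bsub>M\<^esub> y) = \<ominus>\<^bsub>N\<^esub> h y"
    using linear_map_smult[OF h] linear_map_closed[OF h] y by (simp add: N.smult_l_minus)
  then show ?thesis
    using linear_map_add[OF h] x y by (simp add: a_minus_def)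
qed

lemma linear_map_id: "linear_map K M M (\<lambda>x. x)"
  by (simp add: linear_map_def)

lemma linear_map_comp:
  "\<lbrakk>linear_map K M N f; linear_map K N P g\<rbrakk> \<Longrightarrow> linear_map K M P (\<lambda>x. g (f x))"
  by (simp add: linear_map_def)

lemma linear_map_plus:
  assumes "module K N" "linear_map K M N f" "linear_map K M N g"
  shows "linear_map K M N (\<lambda>x. f x \<oplus>\<^bsub>N\<^esub> g x)"
proof -
  interpret N: module K N by fact
  show ?thesis
    by (rule linear_mapI)
      (use assms in \<open>auto simp: linear_mapD N.M.a_ac N.smult_r_distr\<close>)
qed

lemma linear_map_diff:
  assumes "module K N" "linear_map K M N f" "linear_map K M N g"
  shows "linear_map K M N (\<lambda>x. f x \<ominus>\<^bsub>N\<^esub> g x)"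
proof -
  interpret N: module K N by fact
  show ?thesis
    by (rule linear_mapI)
      (use assms in \<open>auto simp: linear_mapD N.M.a_ac N.smult_r_distr a_minus_def
         N.M.minus_add N.smult_r_minus\<close>)
qed

lemma (in module) linear_map_smult_by:
  "r \<in> carrier R \<Longrightarrow> linear_map R M M (\<lambda>x. r \<odot>\<^bsub>M\<^esub> x)"
proof (rule linear_mapI)
  fix s x assume "r \<in> carrier R" "s \<in> carrier R" "x \<in> carrier M"
  then show "r \<odot>\<^bsub>M\<^esub> (s \<odot>\<^bsub>M\<^esub> x) = s \<odot>\<^bsub>M\<^esub> (r \<odot>\<^bsub>M\<^esub> x)"
    by (metis R.m_comm smult_assoc1)
qed (simp_all add: smult_r_distr)

lemma bilinear_map_comp2:
  assumes "bilinear_map K V W P g" "linear_map K V' V f" "linear_map K W' W h"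
  shows "bilinear_map K V' W' P (\<lambda>v w. g (f v) (h w))"
  unfolding bilinear_map_def
proof (intro conjI ballI)
  fix v assume "v \<in> carrier V'"
  then show "linear_map K W' P (\<lambda>w. g (f v) (h w))"
    by (intro linear_map_comp[OF assms(3)] bilinear_map_right[OF assms(1)]
        linear_map_closed[OF assms(2)])
next
  fix w assume "w \<in> carrier W'"
  then show "linear_map K V' P (\<lambda>v. g (f v) (h w))"
    by (intro linear_map_comp[OF assms(2)] bilinear_map_left[OF assms(1)]
        linear_map_closed[OF assms(3)])
qed

lemma bilinear_map_plus:
  assumes "module K P" "bilinear_map K V W P f" "bilinear_map K V W P g"
  shows "bilinear_map K V W P (\<lambda>v w. f v w \<oplus>\<^bsub>P\<^esub> g v w)"
  using assms(2,3) unfolding bilinear_map_def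
  by (intro conjI ballI linear_map_plus[OF assms(1)]) simp_all

lemma bilinear_map_diff:
  assumes "module K P" "bilinear_map K V W P f" "bilinear_map K V W P g"
  shows "bilinear_map K V W P (\<lambda>v w. f v w \<ominus>\<^bsub>P\<^esub> g v w)"
  using assms(2,3) unfolding bilinear_map_def
  by (intro conjI ballI linear_map_diff[OF assms(1)]) simp_all

lemma bilinear_map_linear_comp:
  assumes "bilinear_map K V W P f" "linear_map K P Q h"
  shows "bilinear_map K V W Q (\<lambda>v w. h (f v w))"
  unfolding bilinear_map_def
  by (intro conjI ballI linear_map_comp[OF _ assms(2)])
    (simp_all add: bilinear_mapD[OF assms(1)])

lemma bilinear_map_swap: "bilinear_map K V W P f \<Longrightarrow> bilinear_map K W V P (\<lambda>w v. f v w)"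
  unfolding bilinear_map_def by blast

section \<open>Free modules\<close>

lemma free_module_is_module:
  fixes K :: "('k, 'm) ring_scheme" and S :: "'s set"
  assumes "cring K"
  shows "module K (free_module K S)"
proof -
  interpret cring K by fact
  let ?F = "free_module K S"
  have fin_add: "finite {s. f s \<oplus>\<^bsub>K\<^esub> g s \<noteq> \<zero>\<^bsub>K\<^esub>}"
    if "finite {s. f s \<noteq> \<zero>\<^bsub>K\<^esub>}" "finite {s. g s \<noteq> \<zero>\<^bsub>K\<^esub>}" for f g :: "'s \<Rightarrow> 'k"
    by (rule finite_subset[OF _ finite_UnI[OF that]]) auto
  have fin_smult: "finite {s. r \<otimes>\<^bsub>K\<^esub> f s \<noteq> \<zero>\<^bsub>K\<^esub>}"
    if "finite {s. f s \<noteq> \<zero>\<^bsub>K\<^esub>}" "r \<in> carrier K" for r and f :: "'s \<Rightarrow> 'k"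
    by (rule finite_subset[OF _ that(1)]) (use that in auto)
  show ?thesis
  proof (rule moduleI)
    show "abelian_group ?F"
    proof (rule abelian_groupI)
      fix f assume f: "f \<in> carrier ?F"
      show "\<exists>g\<in>carrier ?F. g \<oplus>\<^bsub>?F\<^esub> f = \<zero>\<^bsub>?F\<^esub>"
      proof
        have "{s. \<ominus>\<^bsub>K\<^esub> f s \<noteq> \<zero>\<^bsub>K\<^esub>} \<subseteq> {s. f s \<noteq> \<zero>\<^bsub>K\<^esub>}" by auto
        then show "(\<lambda>s. \<ominus>\<^bsub>K\<^esub> f s) \<in> carrier ?F"
          using f finite_subset by (auto simp: free_module_def)
        show "(\<lambda>s. \<ominus>\<^bsub>K\<^esub> f s) \<oplus>\<^bsub>?F\<^esub> f = \<zero>\<^bsub>?F\<^esub>"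
          using f by (auto simp: free_module_def l_neg)
      qed
    qed (auto simp: free_module_def fin_add a_ac)
  qed (auto simp: free_module_def fin_smult l_distr r_distr m_assoc assms)
qed

lemma basis_elt_closed:
  assumes "cring K" "s \<in> S"
  shows "basis_elt K s \<in> carrier (free_module K S)"
proof -
  interpret cring K by fact
  have "{t. basis_elt K s t \<noteq> \<zero>\<^bsub>K\<^esub>} \<subseteq> {s}" by (auto simp: basis_elt_def)
  then have "finite {t. basis_elt K s t \<noteq> \<zero>\<^bsub>K\<^esub>}" using finite_subset by blast
  then show ?thesis using assms(2) by (auto simp: free_module_def basis_elt_def)
qed

text \<open>The support of a finitely supported function shrinks by one point when a multiple of a basis
  element is split off.\<close>

lemma free_module_induct [consumes 2, case_names zero basis add]:
  assumes K: "cring K" and f: "f \<in> carrier (free_module K S)"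
    and zero: "P \<zero>\<^bsub>free_module K S\<^esub>"
    and basis: "\<And>r s. \<lbrakk>r \<in> carrier K; s \<in> S\<rbrakk> \<Longrightarrow> P (r \<odot>\<^bsub>free_module K S\<^esub> basis_elt K s)"
    and add: "\<And>f g. \<lbrakk>f \<in> carrier (free_module K S); g \<in> carrier (free_module K S); P f; P g\<rbrakk>
       \<Longrightarrow> P (f \<oplus>\<^bsub>free_module K S\<^esub> g)"
  shows "P f"
proof -
  interpret cring K by fact
  let ?F = "free_module K S"
  interpret F: module K ?F by (rule free_module_is_module[OF K])
  have "P f" if "finite T" "{s. f s \<noteq> \<zero>\<^bsub>K\<^esub>} \<subseteq> T" "f \<in> carrier ?F" for T f
    using that
  proof (induction T arbitrary: f rule: finite_induct)
    case empty
    then have "f = \<zero>\<^bsub>?F\<^esub>" by (auto simp: free_module_def)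
    then show ?case using zero by simp
  next
    case (insert t T)
    show ?case
    proof (cases "t \<in> S")
      case True
      let ?g = "f(t := \<zero>\<^bsub>K\<^esub>)"
      have sub: "{s. ?g s \<noteq> \<zero>\<^bsub>K\<^esub>} \<subseteq> T" using insert.prems(1) by auto
      then have g: "?g \<in> carrier ?F"
        using insert.prems(2) finite_subset[OF sub insert.hyps(1)] by (auto simp: free_module_def)
      have ft: "f t \<in> carrier K" using insert.prems(2) by (auto simp: free_module_def)
      have "f = (f t \<odot>\<^bsub>?F\<^esub> basis_elt K t) \<oplus>\<^bsub>?F\<^esub> ?g"
        using insert.prems(2) by (auto simp: free_module_def basis_elt_def)
      moreover have "P ((f t \<odot>\<^bsub>?F\<^esub> basis_elt K t) \<oplus>\<^bsub>?F\<^esub> ?g)"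
        by (rule add[OF F.smult_closed[OF ft basis_elt_closed[OF K True]] g basis[OF ft True]
              insert.IH[OF sub g]])
      ultimately show ?thesis by simp
    next
      case False
      then have "f t = \<zero>\<^bsub>K\<^esub>" using insert.prems(2) by (auto simp: free_module_def)
      then have "{s. f s \<noteq> \<zero>\<^bsub>K\<^esub>} \<subseteq> T" using insert.prems(1) by auto
      then show ?thesis using insert.IH insert.prems(2) by blast
    qed
  qed
  moreover have "finite {s. f s \<noteq> \<zero>\<^bsub>K\<^esub>}" using f by (auto simp: free_module_def)
  ultimately show ?thesis using f by blast
qed

text \<open>The linear extension of a map \<open>g\<close> on the basis.\<close>

definition free_lift ::
  "('k, 'm) ring_scheme \<Rightarrow> ('k, 'a, 'p) module_scheme \<Rightarrow> ('s \<Rightarrow> 'a) \<Rightarrow> ('s \<Rightarrow> 'k) \<Rightarrow> 'a" where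
  "free_lift K P g f = (\<Oplus>\<^bsub>P\<^esub>s \<in> {s. f s \<noteq> \<zero>\<^bsub>K\<^esub>}. f s \<odot>\<^bsub>P\<^esub> g s)"

text \<open>The support of a sum is not the union of the supports, since coefficients may cancel.  Being
  able to sum over any larger finite set of basis indices avoids this difficulty.\<close>

lemma free_lift_superset:
  assumes "module K P" and g: "\<And>s. s \<in> S \<Longrightarrow> g s \<in> carrier P"
    and f: "\<And>s. f s \<in> carrier K"
    and T: "finite T" "{s. f s \<noteq> \<zero>\<^bsub>K\<^esub>} \<subseteq> T" "T \<subseteq> S"
  shows "free_lift K P g f = (\<Oplus>\<^bsub>P\<^esub>s \<in> T. f s \<odot>\<^bsub>P\<^esub> g s)"
proof -
  interpret P: module K P by fact
  show ?thesis
    unfolding free_lift_def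
    by (rule P.M.add.finprod_mono_neutral_cong_left) (use assms in auto)
qed

lemma free_lift_basis_elt:
  assumes "module K P" and "g s \<in> carrier P"
  shows "free_lift K P g (basis_elt K s) = g s"
proof -
  interpret P: module K P by fact
  have "free_lift K P g (basis_elt K s) = (\<Oplus>\<^bsub>P\<^esub>t \<in> {s}. basis_elt K s t \<odot>\<^bsub>P\<^esub> g t)"
    by (rule free_lift_superset[where S = "{s}"]) (use assms in \<open>auto simp: basis_elt_def\<close>)
  also have "\<dots> = g s"
    using assms(2) by (simp add: basis_elt_def P.M.finsum_insert P.M.finsum_empty)
  finally show ?thesis .
qed

lemma linear_map_free_lift:
  assumes "module K P" and g: "\<And>s. s \<in> S \<Longrightarrow> g s \<in> carrier P"
  shows "linear_map K (free_module K S) P (free_lift K P g)"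
proof -
  interpret P: module K P by fact
  let ?F = "free_module K S"
  have F: "\<And>s. f s \<in> carrier K" "finite {s. f s \<noteq> \<zero>\<^bsub>K\<^esub>}" "{s. f s \<noteq> \<zero>\<^bsub>K\<^esub>} \<subseteq> S"
    if "f \<in> carrier ?F" for f
    using that by (auto simp: free_module_def)
  show ?thesis
  proof (rule linear_mapI)
    fix f assume f: "f \<in> carrier ?F"
    have "(\<lambda>s. f s \<odot>\<^bsub>P\<^esub> g s) \<in> {s. f s \<noteq> \<zero>\<^bsub>K\<^esub>} \<rightarrow> carrier P"
      using F[OF f] g by auto
    then show "free_lift K P g f \<in> carrier P"
      unfolding free_lift_def by (rule P.M.finsum_closed)
  next
    fix f f' assume f: "f \<in> carrier ?F" and f': "f' \<in> carrier ?F"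
    let ?T = "{s. f s \<noteq> \<zero>\<^bsub>K\<^esub>} \<union> {s. f' s \<noteq> \<zero>\<^bsub>K\<^esub>}"
    have T: "finite ?T" "?T \<subseteq> S" using F[OF f] F[OF f'] by auto
    have eq: "f \<oplus>\<^bsub>?F\<^esub> f' = (\<lambda>s. f s \<oplus>\<^bsub>K\<^esub> f' s)" by (simp add: free_module_def)
    have "free_lift K P g (f \<oplus>\<^bsub>?F\<^esub> f') = (\<Oplus>\<^bsub>P\<^esub>s \<in> ?T. (f s \<oplus>\<^bsub>K\<^esub> f' s) \<odot>\<^bsub>P\<^esub> g s)"
      unfolding eq
      by (rule free_lift_superset[where S = S])
        (use assms T F[OF f] F[OF f'] in auto)
    also have "\<dots> = (\<Oplus>\<^bsub>P\<^esub>s \<in> ?T. f s \<odot>\<^bsub>P\<^esub> g s \<oplus>\<^bsub>P\<^esub> f' s \<odot>\<^bsub>P\<^esub> g s)"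
      by (rule P.M.finsum_cong')
        (use T(2) g F[OF f] F[OF f'] in \<open>auto intro!: P.smult_l_distr\<close>)
    also have "\<dots> = (\<Oplus>\<^bsub>P\<^esub>s \<in> ?T. f s \<odot>\<^bsub>P\<^esub> g s) \<oplus>\<^bsub>P\<^esub> (\<Oplus>\<^bsub>P\<^esub>s \<in> ?T. f' s \<odot>\<^bsub>P\<^esub> g s)"
      by (rule P.M.finsum_addf) (use T(2) g F[OF f] F[OF f'] in auto)
    also have "(\<Oplus>\<^bsub>P\<^esub>s \<in> ?T. f s \<odot>\<^bsub>P\<^esub> g s) = free_lift K P g f"
      by (rule free_lift_superset[where S = S, symmetric]) (use assms T F[OF f] in auto)
    also have "(\<Oplus>\<^bsub>P\<^esub>s \<in> ?T. f' s \<odot>\<^bsub>P\<^esub> g s) = free_lift K P g f'"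
      by (rule free_lift_superset[where S = S, symmetric]) (use assms T F[OF f'] in auto)
    finally show "free_lift K P g (f \<oplus>\<^bsub>?F\<^esub> f') = free_lift K P g f \<oplus>\<^bsub>P\<^esub> free_lift K P g f'" .
  next
    fix r f assume r: "r \<in> carrier K" and f: "f \<in> carrier ?F"
    let ?T = "{s. f s \<noteq> \<zero>\<^bsub>K\<^esub>}"
    have eq: "r \<odot>\<^bsub>?F\<^esub> f = (\<lambda>s. r \<otimes>\<^bsub>K\<^esub> f s)" by (simp add: free_module_def)
    have "free_lift K P g (r \<odot>\<^bsub>?F\<^esub> f) = (\<Oplus>\<^bsub>P\<^esub>s \<in> ?T. (r \<otimes>\<^bsub>K\<^esub> f s) \<odot>\<^bsub>P\<^esub> g s)"
      unfolding eq
      by (rule free_lift_superset[where S = S]) (use assms F[OF f] r in auto)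
    also have "\<dots> = (\<Oplus>\<^bsub>P\<^esub>s \<in> ?T. r \<odot>\<^bsub>P\<^esub> (f s \<odot>\<^bsub>P\<^esub> g s))"
      by (rule P.M.finsum_cong') (use F[OF f] g r in \<open>auto intro!: P.smult_assoc1\<close>)
    also have "\<dots> = r \<odot>\<^bsub>P\<^esub> free_lift K P g f"
      unfolding free_lift_def
      by (rule P.finsum_smult_ldistr[symmetric]) (use F[OF f] g r in auto)
    finally show "free_lift K P g (r \<odot>\<^bsub>?F\<^esub> f) = r \<odot>\<^bsub>P\<^esub> free_lift K P g f" .
  qed
qed

section \<open>Generated submodules and quotient modules\<close>

lemma submodule_generated_submodule:
  assumes "module K M" "S \<subseteq> carrier M"
  shows "submodule (generated_submodule K M S) K M"
proof -
  interpret M: module K M by fact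
  note E = M.submoduleE
  have Z: "\<zero>\<^bsub>M\<^esub> \<in> H" if "submodule H K M" for H
    using subgroup.one_closed[OF submodule.axioms(1)[OF that]] by simp
  show ?thesis
    unfolding generated_submodule_def
    by (rule M.submoduleI)
      (use E(3-5) Z M.carrier_is_submodule assms(2) in \<open>auto 0 3\<close>)
qed

lemma generated_submodule_incl: "S \<subseteq> generated_submodule K M S"
  unfolding generated_submodule_def by blast

lemma generated_submodule_least:
  "\<lbrakk>submodule H K M; S \<subseteq> H\<rbrakk> \<Longrightarrow> generated_submodule K M S \<subseteq> H"
  unfolding generated_submodule_def by blast

lemma submodule_kernel:
  assumes "module K M" "module K N" and h: "linear_map K M N h"
  shows "submodule {x \<in> carrier M. h x = \<zero>\<^bsub>N\<^esub>} K M"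
proof -
  interpret M: module K M by fact
  interpret N: module K N by fact
  have 0: "h \<zero>\<^bsub>M\<^esub> = \<zero>\<^bsub>N\<^esub>"
    using linear_map_smult[OF h, of "\<zero>\<^bsub>K\<^esub>" "\<zero>\<^bsub>M\<^esub>"] linear_map_closed[OF h] by simp
  have neg: "h (\<ominus>\<^bsub>M\<^esub> x) = \<ominus>\<^bsub>N\<^esub> h x" if "x \<in> carrier M" for x
    using linear_map_minus[OF assms, of "\<zero>\<^bsub>M\<^esub>" x] that 0 linear_map_closed[OF h that]
    by (simp add: a_minus_def)
  show ?thesis
    by (rule M.submoduleI) (use 0 neg in \<open>auto simp: linear_mapD[OF h]\<close>)
qed

context
  fixes K :: "('k, 'm) ring_scheme" and M :: "('k, 'a, 'n) module_scheme" and N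
  assumes M: "module K M" and N: "submodule N K M"
begin

interpretation M: module K M by (rule M)
interpretation N: submodule N K M by (rule N)
interpretation N: abelian_subgroup N M
  by (rule abelian_subgroupI3)
    (auto intro: additive_subgroup.intro N.subgroup_axioms M.M.abelian_group_axioms)

text \<open>This moves every computation with cosets to membership of a difference in the submodule.\<close>

lemma coset_eq_iff:
  assumes x: "x \<in> carrier M" and y: "y \<in> carrier M"
  shows "N +>\<^bsub>M\<^esub> x = N +>\<^bsub>M\<^esub> y \<longleftrightarrow> x \<ominus>\<^bsub>M\<^esub> y \<in> N"
proof -
  have "N +>\<^bsub>M\<^esub> x = N +>\<^bsub>M\<^esub> y \<longleftrightarrow> x \<in> N +>\<^bsub>M\<^esub> y"
    using N.a_repr_independence'[OF _ y] N.a_rcos_self[OF x] by blast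
  then show ?thesis
    using N.a_rcos_module[OF y x] by (simp add: a_minus_def)
qed

lemma quotient_carrier: "carrier (quotient_module M N) = (\<lambda>x. N +>\<^bsub>M\<^esub> x) ` carrier M"
  by (auto simp: quotient_module_def A_RCOSETS_def')

lemma quotient_add:
  "\<lbrakk>x \<in> carrier M; y \<in> carrier M\<rbrakk>
    \<Longrightarrow> (N +>\<^bsub>M\<^esub> x) \<oplus>\<^bsub>quotient_module M N\<^esub> (N +>\<^bsub>M\<^esub> y) = N +>\<^bsub>M\<^esub> (x \<oplus>\<^bsub>M\<^esub> y)"
  by (simp add: quotient_module_def N.a_rcos_sum)

lemma quotient_zero: "\<zero>\<^bsub>quotient_module M N\<^esub> = N +>\<^bsub>M\<^esub> \<zero>\<^bsub>M\<^esub>"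
  by (simp add: quotient_module_def N.a_rcos_const)

text \<open>Scalar multiplication of a coset is a union over all of its elements.  Two of these differ by an
  element \<open>n\<close> of \<open>N\<close>, so their multiples differ by \<open>r n\<close>, and the cosets united here all coincide.\<close>

lemma quotient_smult:
  assumes r: "r \<in> carrier K" and x: "x \<in> carrier M"
  shows "r \<odot>\<^bsub>quotient_module M N\<^esub> (N +>\<^bsub>M\<^esub> x) = N +>\<^bsub>M\<^esub> (r \<odot>\<^bsub>M\<^esub> x)"
proof -
  have "N +>\<^bsub>M\<^esub> (r \<odot>\<^bsub>M\<^esub> y) = N +>\<^bsub>M\<^esub> (r \<odot>\<^bsub>M\<^esub> x)" if y: "y \<in> N +>\<^bsub>M\<^esub> x" for y
  proof -
    have yc: "y \<in> carrier M" using N.a_elemrcos_carrier x y by blast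
    have "y \<ominus>\<^bsub>M\<^esub> x \<in> N"
      using coset_eq_iff[OF yc x] N.a_repr_independence'[OF y x] by simp
    then have "r \<odot>\<^bsub>M\<^esub> (y \<ominus>\<^bsub>M\<^esub> x) \<in> N" using r by simp
    then show ?thesis
      using coset_eq_iff r x yc by (simp add: a_minus_def M.smult_r_distr M.smult_r_minus)
  qed
  then have "(\<Union>y \<in> N +>\<^bsub>M\<^esub> x. N +>\<^bsub>M\<^esub> (r \<odot>\<^bsub>M\<^esub> y)) = N +>\<^bsub>M\<^esub> (r \<odot>\<^bsub>M\<^esub> x)"
    using N.a_rcos_self[OF x] by blast
  then show ?thesis by (simp add: quotient_module_def)
qed

lemma quotient_module_is_module: "module K (quotient_module M N)"
proof -
  let ?Q = "quotient_module M N"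
  note Q = quotient_carrier quotient_add quotient_zero quotient_smult
  show ?thesis
  proof (rule moduleI)
    show "cring K" by (rule M.R.is_cring)
    show "abelian_group ?Q"
    proof (rule abelian_groupI)
      fix X assume "X \<in> carrier ?Q"
      then obtain x where x: "x \<in> carrier M" "X = N +>\<^bsub>M\<^esub> x" by (auto simp: Q)
      then show "\<exists>Y\<in>carrier ?Q. Y \<oplus>\<^bsub>?Q\<^esub> X = \<zero>\<^bsub>?Q\<^esub>"
        by (intro bexI[of _ "N +>\<^bsub>M\<^esub> (\<ominus>\<^bsub>M\<^esub> x)"]) (auto simp: Q M.M.l_neg)
    qed (auto simp: Q M.M.a_ac)
  qed (auto simp: Q M.smult_l_distr M.smult_r_distr M.smult_assoc1)
qed

lemma linear_map_coset: "linear_map K M (quotient_module M N) (\<lambda>x. N +>\<^bsub>M\<^esub> x)"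
  unfolding linear_map_def using quotient_carrier quotient_add quotient_smult by auto

context
  fixes P :: "('k, 'b, 'q) module_scheme" and h
  assumes P: "module K P" and h: "linear_map K M P h" and ker: "\<And>x. x \<in> N \<Longrightarrow> h x = \<zero>\<^bsub>P\<^esub>"
begin

text \<open>A linear map that vanishes on \<open>N\<close> is constant on the cosets of \<open>N\<close>, so its value at an arbitrarily
  chosen element determines a map on the quotient.\<close>

lemma quotient_lift_coset:
  assumes x: "x \<in> carrier M"
  shows "h (SOME y. y \<in> N +>\<^bsub>M\<^esub> x) = h x"
proof -
  interpret P: module K P by (rule P)
  let ?y = "SOME y. y \<in> N +>\<^bsub>M\<^esub> x"
  have y: "?y \<in> N +>\<^bsub>M\<^esub> x" 
    by (rule someI[of "\<lambda>y. y \<in> N +>\<^bsub>M\<^esub> x", OF N.a_rcos_self[OF x]])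
  have yc: "?y \<in> carrier M" using N.a_elemrcos_carrier x y by blast
  have "?y \<ominus>\<^bsub>M\<^esub> x \<in> N" using coset_eq_iff[OF yc x] N.a_repr_independence'[OF y x] by simp
  then have "h ?y \<ominus>\<^bsub>P\<^esub> h x = \<zero>\<^bsub>P\<^esub>"
    using ker linear_map_minus[OF M P h yc x] by simp
  then show ?thesis
    using linear_map_closed[OF h] x yc by (simp add: P.M.minus_eq_zero_iff)
qed

lemma linear_map_quotient_lift:
  "linear_map K (quotient_module M N) P (\<lambda>X. h (SOME y. y \<in> X))"
proof (rule linear_mapI)
  fix X assume "X \<in> carrier (quotient_module M N)"
  then show "h (SOME y. y \<in> X) \<in> carrier P"
    by (auto simp: quotient_carrier quotient_lift_coset linear_map_closed[OF h])
next
  fix X Y assume "X \<in> carrier (quotient_module M N)" "Y \<in> carrier (quotient_module M N)"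
  then show "h (SOME y. y \<in> X \<oplus>\<^bsub>quotient_module M N\<^esub> Y)
      = h (SOME y. y \<in> X) \<oplus>\<^bsub>P\<^esub> h (SOME y. y \<in> Y)"
    by (auto simp: quotient_carrier quotient_add quotient_lift_coset linear_map_add[OF h])
next
  fix r X assume "r \<in> carrier K" "X \<in> carrier (quotient_module M N)"
  then show "h (SOME y. y \<in> r \<odot>\<^bsub>quotient_module M N\<^esub> X) = r \<odot>\<^bsub>P\<^esub> h (SOME y. y \<in> X)"
    by (auto simp: quotient_carrier quotient_smult quotient_lift_coset linear_map_smult[OF h])
qed

end

end

section \<open>Tensor products\<close>

text \<open>The map on the tensor product induced by a bilinear \<open>g\<close>, evaluated on a formal combination of pairs
  chosen from the coset; for bilinear \<open>g\<close> the choice does not matter.\<close>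

definition tensor_lift ::
  "('k, 'm) ring_scheme \<Rightarrow> ('k, 'c, 'r) module_scheme \<Rightarrow> ('a \<Rightarrow> 'b \<Rightarrow> 'c)
     \<Rightarrow> ('a \<times> 'b \<Rightarrow> 'k) set \<Rightarrow> 'c" where
  "tensor_lift K P g X = free_lift K P (case_prod g) (SOME f. f \<in> X)"

locale module_pair = V: module K V + W: module K W
  for K :: "('k, 'm) ring_scheme"
    and V :: "('k, 'a, 'p) module_scheme"
    and W :: "('k, 'b, 'q) module_scheme"
begin

abbreviation (input) "F \<equiv> free_module K (carrier V \<times> carrier W)"
abbreviation (input) "T \<equiv> tensor_module K V W"
abbreviation (input) "Z \<equiv> tensor_null K V W"
abbreviation (input) "e v w \<equiv> basis_elt K (v, w)"
abbreviation (input) "pt \<equiv> pure_tensor K V W"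

lemma free_on_pairs: "module K F"
  by (rule free_module_is_module[OF V.R.is_cring])

interpretation F: module K F by (rule free_on_pairs)

lemma basis_pair_closed:
  "\<lbrakk>v \<in> carrier V; w \<in> carrier W\<rbrakk> \<Longrightarrow> e v w \<in> carrier F"
  by (rule basis_elt_closed[OF V.R.is_cring]) simp

lemma tensor_relations_subset: "tensor_relations K V W \<subseteq> carrier F"
  unfolding tensor_relations_def Let_def
  by (intro Un_least subsetI; elim CollectE exE conjE; simp add: basis_pair_closed F.M.minus_closed)

lemma submodule_tensor_null: "submodule Z K F"
  unfolding tensor_null_def
  by (rule submodule_generated_submodule[OF free_on_pairs tensor_relations_subset])

lemma module_tensor: "module K T"
  unfolding tensor_module_def
  by (rule quotient_module_is_module[OF free_on_pairs submodule_tensor_null])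

interpretation T: module K T by (rule module_tensor)

lemma linear_map_tensor_coset: "linear_map K F T (\<lambda>f. Z +>\<^bsub>F\<^esub> f)"
  unfolding tensor_module_def
  by (rule linear_map_coset[OF free_on_pairs submodule_tensor_null])

lemma coset_eq_if_relation:
  assumes "f \<in> carrier F" "g \<in> carrier F" "f \<ominus>\<^bsub>F\<^esub> g \<in> tensor_relations K V W"
  shows "Z +>\<^bsub>F\<^esub> f = Z +>\<^bsub>F\<^esub> g"
proof -
  have "f \<ominus>\<^bsub>F\<^esub> g \<in> Z"
    unfolding tensor_null_def by (rule subsetD[OF generated_submodule_incl assms(3)])
  then show ?thesis
    by (rule coset_eq_iff[OF free_on_pairs submodule_tensor_null assms(1,2), THEN iffD2])
qed

text \<open>Each clause of bilinearity is one of the four families of relations that are divided out.\<close>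

lemma bilinear_map_pure_tensor: "bilinear_map K V W T pt"
proof -
  note coset = linear_mapD[OF linear_map_tensor_coset]
  note e = basis_pair_closed
  have add1: "pt (v \<oplus>\<^bsub>V\<^esub> v') w = pt v w \<oplus>\<^bsub>T\<^esub> pt v' w"
    if "v \<in> carrier V" "v' \<in> carrier V" "w \<in> carrier W" for v v' w
  proof -
    have "Z +>\<^bsub>F\<^esub> e (v \<oplus>\<^bsub>V\<^esub> v') w = Z +>\<^bsub>F\<^esub> (e v w \<oplus>\<^bsub>F\<^esub> e v' w)"
      by (rule coset_eq_if_relation)
        (use that in \<open>auto simp: e tensor_relations_def Let_def\<close>)
    then show ?thesis using that by (simp add: pure_tensor_def coset e)
  qed
  have add2: "pt v (w \<oplus>\<^bsub>W\<^esub> w') = pt v w \<oplus>\<^bsub>T\<^esub> pt v w'"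
    if "v \<in> carrier V" "w \<in> carrier W" "w' \<in> carrier W" for v w w'
  proof -
    have "Z +>\<^bsub>F\<^esub> e v (w \<oplus>\<^bsub>W\<^esub> w') = Z +>\<^bsub>F\<^esub> (e v w \<oplus>\<^bsub>F\<^esub> e v w')"
      by (rule coset_eq_if_relation)
        (use that in \<open>auto simp: e tensor_relations_def Let_def\<close>)
    then show ?thesis using that by (simp add: pure_tensor_def coset e)
  qed
  have smult1: "pt (r \<odot>\<^bsub>V\<^esub> v) w = r \<odot>\<^bsub>T\<^esub> pt v w"
    if "r \<in> carrier K" "v \<in> carrier V" "w \<in> carrier W" for r v w
  proof -
    have "Z +>\<^bsub>F\<^esub> e (r \<odot>\<^bsub>V\<^esub> v) w = Z +>\<^bsub>F\<^esub> (r \<odot>\<^bsub>F\<^esub> e v w)"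
      by (rule coset_eq_if_relation)
        (use that in \<open>auto simp: e tensor_relations_def Let_def\<close>)
    then show ?thesis using that by (simp add: pure_tensor_def coset e)
  qed
  have smult2: "pt v (r \<odot>\<^bsub>W\<^esub> w) = r \<odot>\<^bsub>T\<^esub> pt v w"
    if "r \<in> carrier K" "v \<in> carrier V" "w \<in> carrier W" for r v w
  proof -
    have "Z +>\<^bsub>F\<^esub> e v (r \<odot>\<^bsub>W\<^esub> w) = Z +>\<^bsub>F\<^esub> (r \<odot>\<^bsub>F\<^esub> e v w)"
      by (rule coset_eq_if_relation)
        (use that in \<open>auto simp: e tensor_relations_def Let_def\<close>)
    then show ?thesis using that by (simp add: pure_tensor_def coset e)
  qed
  have closed: "pt v w \<in> carrier T" if "v \<in> carrier V" "w \<in> carrier W" for v w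
    using that by (simp add: pure_tensor_def coset e)
  show ?thesis
    unfolding bilinear_map_def
    by (auto intro!: linear_mapI simp: add1 add2 smult1 smult2 closed)
qed

lemma pure_tensor_closed:
  "\<lbrakk>v \<in> carrier V; w \<in> carrier W\<rbrakk> \<Longrightarrow> pt v w \<in> carrier T"
  by (rule bilinear_map_closed[OF bilinear_map_pure_tensor])

text \<open>Every formal combination of pairs is a sum of multiples of pairs, and the multiples
  \<open>r (v \<otimes> w) = (r v) \<otimes> w\<close> as well as \<open>0 = 0 \<otimes> 0\<close> are themselves pure.\<close>

lemma tensor_induct [consumes 1, case_names pure add]:
  assumes X: "X \<in> carrier T"
    and pure: "\<And>v w. \<lbrakk>v \<in> carrier V; w \<in> carrier W\<rbrakk> \<Longrightarrow> Q (pt v w)"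
    and add: "\<And>X Y. \<lbrakk>X \<in> carrier T; Y \<in> carrier T; Q X; Q Y\<rbrakk> \<Longrightarrow> Q (X \<oplus>\<^bsub>T\<^esub> Y)"
  shows "Q X"
proof -
  note coset = linear_mapD[OF linear_map_tensor_coset]
  have scaled: "Q (Z +>\<^bsub>F\<^esub> (r \<odot>\<^bsub>F\<^esub> e v w))"
    if "r \<in> carrier K" "v \<in> carrier V" "w \<in> carrier W" for r v w
  proof -
    have "Z +>\<^bsub>F\<^esub> (r \<odot>\<^bsub>F\<^esub> e v w) = r \<odot>\<^bsub>T\<^esub> pt v w"
      unfolding pure_tensor_def by (rule coset(3)[OF that(1) basis_pair_closed[OF that(2,3)]])
    also have "\<dots> = pt (r \<odot>\<^bsub>V\<^esub> v) w"
      using linear_map_smult[OF bilinear_map_left[OF bilinear_map_pure_tensor that(3)] that(1,2)] ..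
    finally show ?thesis using pure that by simp
  qed
  have "Q (Z +>\<^bsub>F\<^esub> f)" if "f \<in> carrier F" for f
    using V.R.is_cring that
  proof (induction rule: free_module_induct)
    case zero
    have "\<zero>\<^bsub>F\<^esub> = \<zero>\<^bsub>K\<^esub> \<odot>\<^bsub>F\<^esub> e \<zero>\<^bsub>V\<^esub> \<zero>\<^bsub>W\<^esub>"
      by (rule F.smult_l_null[symmetric]) (simp add: basis_pair_closed)
    then show ?case
      using scaled[of "\<zero>\<^bsub>K\<^esub>" "\<zero>\<^bsub>V\<^esub>" "\<zero>\<^bsub>W\<^esub>"] by simp
  next
    case (basis r s)
    then obtain v w where s: "s = (v, w)" "v \<in> carrier V" "w \<in> carrier W" by auto
    then show ?case using basis(1) by (simp add: scaled)
  next
    case (add f g)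
    then show ?case using assms(3) coset by simp
  qed
  moreover obtain f where "f \<in> carrier F" "X = Z +>\<^bsub>F\<^esub> f"
    using X quotient_carrier[OF free_on_pairs submodule_tensor_null]
    unfolding tensor_module_def by auto
  ultimately show ?thesis by simp
qed

lemma linear_map_tensor_eq:
  assumes "linear_map K T P f" "linear_map K T P g"
    and "\<And>v w. \<lbrakk>v \<in> carrier V; w \<in> carrier W\<rbrakk> \<Longrightarrow> f (pt v w) = g (pt v w)"
    and "X \<in> carrier T"
  shows "f X = g X"
  using assms(4)
  by (induction rule: tensor_induct)
    (simp_all add: assms(3) linear_map_add[OF assms(1)] linear_map_add[OF assms(2)])

context
  fixes P :: "('k, 'c, 'r) module_scheme" and g
  assumes P: "module K P" and g: "bilinear_map K V W P g"
begin

interpretation P: module K P by (rule P)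

lemma linear_map_free_lift_bilinear: "linear_map K F P (free_lift K P (case_prod g))"
  by (rule linear_map_free_lift[OF P]) (auto intro: bilinear_map_closed[OF g])

lemma free_lift_basis_pair:
  "\<lbrakk>v \<in> carrier V; w \<in> carrier W\<rbrakk> \<Longrightarrow> free_lift K P (case_prod g) (e v w) = g v w"
  by (simp add: free_lift_basis_elt[OF P] bilinear_map_closed[OF g])

text \<open>By bilinearity of \<open>g\<close>, the kernel of its linear extension contains the defining relations, and it
  is a submodule.\<close>

lemma free_lift_tensor_null:
  assumes "f \<in> Z"
  shows "free_lift K P (case_prod g) f = \<zero>\<^bsub>P\<^esub>"
proof -
  let ?h = "free_lift K P (case_prod g)"
  note h = linear_map_free_lift_bilinear
  note simps = linear_map_minus[OF free_on_pairs P h] linear_mapD[OF h] free_lift_basis_pair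
    bilinear_map_closed[OF g] linear_mapD[OF bilinear_map_left[OF g]]
    linear_mapD[OF bilinear_map_right[OF g]] basis_pair_closed P.M.minus_eq_zero_iff
  have "tensor_relations K V W \<subseteq> {f \<in> carrier F. ?h f = \<zero>\<^bsub>P\<^esub>}"
    unfolding tensor_relations_def Let_def
    by (intro Un_least subsetI; elim CollectE exE conjE; simp add: simps F.M.minus_closed)
  then have "Z \<subseteq> {f \<in> carrier F. ?h f = \<zero>\<^bsub>P\<^esub>}"
    unfolding tensor_null_def
    by (intro generated_submodule_least submodule_kernel[OF free_on_pairs P h])
  then show ?thesis using assms by blast
qed

lemma linear_map_tensor_lift: "linear_map K T P (tensor_lift K P g)"
  using linear_map_quotient_lift[OF free_on_pairs submodule_tensor_null P
      linear_map_free_lift_bilinear free_lift_tensor_null]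
  unfolding tensor_lift_def tensor_module_def .

lemma tensor_lift_pure:
  assumes "v \<in> carrier V" "w \<in> carrier W"
  shows "tensor_lift K P g (pt v w) = g v w"
  using quotient_lift_coset[OF free_on_pairs submodule_tensor_null P
      linear_map_free_lift_bilinear free_lift_tensor_null, OF _ basis_pair_closed[OF assms]]
  unfolding tensor_lift_def pure_tensor_def
  by (simp add: free_lift_basis_pair assms)

end


lemma bilinear_map_tensor_eq:
  assumes f: "bilinear_map K T T P f" and g: "bilinear_map K T T P g"
    and pure: "\<And>v w v' w'. \<lbrakk>v \<in> carrier V; w \<in> carrier W; v' \<in> carrier V; w' \<in> carrier W\<rbrakk>
      \<Longrightarrow> f (pt v w) (pt v' w') = g (pt v w) (pt v' w')"
    and X: "X \<in> carrier T" and Y: "Y \<in> carrier T"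
  shows "f X Y = g X Y"
proof (rule linear_map_tensor_eq[OF bilinear_map_right[OF f X] bilinear_map_right[OF g X] _ Y])
  fix v' w' assume vw': "v' \<in> carrier V" "w' \<in> carrier W"
  then have p: "pt v' w' \<in> carrier T" by (rule pure_tensor_closed)
  show "f X (pt v' w') = g X (pt v' w')"
    by (rule linear_map_tensor_eq[OF bilinear_map_left[OF f p] bilinear_map_left[OF g p] _ X])
      (rule pure[OF _ _ vw'])
qed

text \<open>The universal property in both arguments.  For fixed \<open>(v, w)\<close> it gives a linear map \<open>l v w\<close> in
  the second argument.  Evaluating these at a fixed tensor \<open>Y\<close> gives a map that is bilinear in \<open>(v, w)\<close>
  (checked on pure \<open>Y\<close>), so the property applies again.  Linearity of the result in \<open>Y\<close> is then
  checked on pure tensors in the first argument.  Currying in this way replaces the module of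
  linear maps by pointwise identities.\<close>

lemma bilinear_map_tensor_exists:
  fixes P :: "('k, 'c, 'r) module_scheme"
  assumes P: "module K P"
    and right: "\<And>v w. \<lbrakk>v \<in> carrier V; w \<in> carrier W\<rbrakk> \<Longrightarrow> bilinear_map K V W P (g v w)"
    and left: "\<And>v' w'. \<lbrakk>v' \<in> carrier V; w' \<in> carrier W\<rbrakk>
      \<Longrightarrow> bilinear_map K V W P (\<lambda>v w. g v w v' w')"
  shows "\<exists>f. bilinear_map K T T P f \<and>
    (\<forall>v \<in> carrier V. \<forall>w \<in> carrier W. \<forall>v' \<in> carrier V. \<forall>w' \<in> carrier W.
      f (pt v w) (pt v' w') = g v w v' w')"
proof -
  interpret P: module K P by (rule P)
  define l where "l v w = tensor_lift K P (g v w)" for v w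
  define f where "f X Y = tensor_lift K P (\<lambda>v w. l v w Y) X" for X Y
  have l: "linear_map K T P (l v w)" if "v \<in> carrier V" "w \<in> carrier W" for v w
    unfolding l_def by (rule linear_map_tensor_lift[OF P right[OF that]])
  have l_pure: "l v w (pt v' w') = g v w v' w'"
    if "v \<in> carrier V" "w \<in> carrier W" "v' \<in> carrier V" "w' \<in> carrier W" for v w v' w'
    unfolding l_def by (rule tensor_lift_pure[OF P right[OF that(1,2)] that(3,4)])
  have smult_l: "linear_map K T P (\<lambda>Y. r \<odot>\<^bsub>P\<^esub> l v w Y)"
    if "r \<in> carrier K" "v \<in> carrier V" "w \<in> carrier W" for r v w
    by (rule linear_map_comp[OF l[OF that(2,3)] P.linear_map_smult_by[OF that(1)]])
  have bil: "bilinear_map K V W P (\<lambda>v w. l v w Y)" if Y: "Y \<in> carrier T" for Y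
    unfolding bilinear_map_def
  proof (intro conjI ballI linear_mapI)
    fix v w assume vw: "v \<in> carrier V" "w \<in> carrier W"
    show "l v w Y \<in> carrier P" by (rule linear_map_closed[OF l[OF vw] Y])
    then show "l v w Y \<in> carrier P" .
  next
    fix v w w' assume vw: "v \<in> carrier V" "w \<in> carrier W" "w' \<in> carrier W"
    show "l v (w \<oplus>\<^bsub>W\<^esub> w') Y = l v w Y \<oplus>\<^bsub>P\<^esub> l v w' Y"
      by (rule linear_map_tensor_eq[OF l linear_map_plus[OF P l l] _ Y])
        (use vw in \<open>simp_all add: l_pure linear_map_add[OF bilinear_map_right[OF left]]\<close>)
  next
    fix v r w assume vw: "v \<in> carrier V" "r \<in> carrier K" "w \<in> carrier W"
    show "l v (r \<odot>\<^bsub>W\<^esub> w) Y = r \<odot>\<^bsub>P\<^esub> l v w Y"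
      by (rule linear_map_tensor_eq[OF l smult_l _ Y])
        (use vw in \<open>simp_all add: l_pure linear_map_smult[OF bilinear_map_right[OF left]]\<close>)
  next
    fix w v v' assume vw: "w \<in> carrier W" "v \<in> carrier V" "v' \<in> carrier V"
    show "l (v \<oplus>\<^bsub>V\<^esub> v') w Y = l v w Y \<oplus>\<^bsub>P\<^esub> l v' w Y"
      by (rule linear_map_tensor_eq[OF l linear_map_plus[OF P l l] _ Y])
        (use vw in \<open>simp_all add: l_pure linear_map_add[OF bilinear_map_left[OF left]]\<close>)
  next
    fix w r v assume vw: "w \<in> carrier W" "r \<in> carrier K" "v \<in> carrier V"
    show "l (r \<odot>\<^bsub>V\<^esub> v) w Y = r \<odot>\<^bsub>P\<^esub> l v w Y"
      by (rule linear_map_tensor_eq[OF l smult_l _ Y])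
        (use vw in \<open>simp_all add: l_pure linear_map_smult[OF bilinear_map_left[OF left]]\<close>)
  qed
  have f_left: "linear_map K T P (\<lambda>X. f X Y)" if "Y \<in> carrier T" for Y
    unfolding f_def by (rule linear_map_tensor_lift[OF P bil[OF that]])
  have f_pure: "f (pt v w) Y = l v w Y"
    if "v \<in> carrier V" "w \<in> carrier W" "Y \<in> carrier T" for v w Y
    unfolding f_def by (rule tensor_lift_pure[OF P bil[OF that(3)] that(1,2)])
  have f_right: "linear_map K T P (f X)" if X: "X \<in> carrier T" for X
  proof (rule linear_mapI)
    fix Y assume Y: "Y \<in> carrier T"
    show "f X Y \<in> carrier P" by (rule linear_map_closed[OF f_left[OF Y] X])
  next
    fix Y Y' assume Y: "Y \<in> carrier T" "Y' \<in> carrier T"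
    show "f X (Y \<oplus>\<^bsub>T\<^esub> Y') = f X Y \<oplus>\<^bsub>P\<^esub> f X Y'"
      by (rule linear_map_tensor_eq[OF f_left linear_map_plus[OF P f_left f_left] _ X])
        (use Y in \<open>simp_all add: f_pure linear_map_add[OF l]\<close>)
  next
    fix r Y assume Y: "r \<in> carrier K" "Y \<in> carrier T"
    show "f X (r \<odot>\<^bsub>T\<^esub> Y) = r \<odot>\<^bsub>P\<^esub> f X Y"
      by (rule linear_map_tensor_eq[OF f_left
            linear_map_comp[OF f_left P.linear_map_smult_by] _ X])
        (use Y in \<open>simp_all add: f_pure linear_map_smult[OF l]\<close>)
  qed
  have "bilinear_map K T T P f"
    unfolding bilinear_map_def using f_left f_right by blast
  then show ?thesis
    using f_pure l_pure pure_tensor_closed by (intro exI[of _ f]) simp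
qed

lemma tensor_op_exists:
  assumes f: "bilinear_op K V f" and g: "bilinear_op K W g"
  shows "\<exists>h. bilinear_op K T h \<and>
    (\<forall>v \<in> carrier V. \<forall>v' \<in> carrier V. \<forall>w \<in> carrier W. \<forall>w' \<in> carrier W.
      h (pt v w) (pt v' w') = pt (f v v') (g w w'))"
proof -
  note f' = f[unfolded bilinear_op_iff_bilinear_map] and g' = g[unfolded bilinear_op_iff_bilinear_map]
  have "\<exists>h. bilinear_map K T T T h \<and>
    (\<forall>v \<in> carrier V. \<forall>w \<in> carrier W. \<forall>v' \<in> carrier V. \<forall>w' \<in> carrier W.
      h (pt v w) (pt v' w') = pt (f v v') (g w w'))"
  proof (rule bilinear_map_tensor_exists[OF module_tensor])
    fix v w assume vw: "v \<in> carrier V" "w \<in> carrier W"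
    show "bilinear_map K V W T (\<lambda>v' w'. pt (f v v') (g w w'))"
      by (rule bilinear_map_comp2[OF bilinear_map_pure_tensor
            bilinear_map_right[OF f' vw(1)] bilinear_map_right[OF g' vw(2)]])
    show "bilinear_map K V W T (\<lambda>v' w'. pt (f v' v) (g w' w))"
      by (rule bilinear_map_comp2[OF bilinear_map_pure_tensor
            bilinear_map_left[OF f' vw(1)] bilinear_map_left[OF g' vw(2)]])
  qed
  then show ?thesis unfolding bilinear_op_iff_bilinear_map by blast
qed

end

section \<open>Jacobi Novikov-Poisson algebras as algebras with a generalised derivation\<close>

lemma algebra_mult_bilinear:
  assumes "algebra K A"
  shows "bilinear_op K A (mult A)"
proof -
  interpret A: algebra K A by fact
  have "x \<otimes>\<^bsub>A\<^esub> (r \<odot>\<^bsub>A\<^esub> y) = r \<odot>\<^bsub>A\<^esub> (x \<otimes>\<^bsub>A\<^esub> y)"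
    if "r \<in> carrier K" "x \<in> carrier A" "y \<in> carrier A" for r x y
    using that A.smult_assoc2[of r y x] by (simp add: A.m_comm)
  then show ?thesis
    by (simp add: bilinear_op_def A.l_distr A.r_distr A.smult_assoc2)
qed

text \<open>The twisted Leibniz rule turns the associator into \<open>ab (D(c) D(1) - D(D(c)))\<close>, whose symmetry in
  \<open>a\<close> and \<open>b\<close> is commutativity of the product.  The other axioms are immediate.\<close>

lemma jacobi_novikov_poisson_algebraI_derivation:
  fixes D
  assumes "field K" and "algebra K A" and D: "linear_map K A A D"
    and leibniz: "\<And>a b. \<lbrakk>a \<in> carrier A; b \<in> carrier A\<rbrakk> \<Longrightarrow>
      D (a \<otimes>\<^bsub>A\<^esub> b) = ((D a \<otimes>\<^bsub>A\<^esub> b) \<oplus>\<^bsub>A\<^esub> (a \<otimes>\<^bsub>A\<^esub> D b)) \<ominus>\<^bsub>A\<^esub> ((a \<otimes>\<^bsub>A\<^esub> b) \<otimes>\<^bsub>A\<^esub> D \<one>\<^bsub>A\<^esub>)"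
    and circ: "\<And>a b. \<lbrakk>a \<in> carrier A; b \<in> carrier A\<rbrakk> \<Longrightarrow> a \<circ>\<^bsub>A\<^esub> b = a \<otimes>\<^bsub>A\<^esub> D b"
  shows "jacobi_novikov_poisson_algebra K A"
proof -
  interpret K: field K by fact
  interpret A: algebra K A by fact
  note [simp] = circ and D_simps [simp] = linear_mapD[OF D]
  have "bilinear_op K A (\<lambda>a b. a \<otimes>\<^bsub>A\<^esub> D b)"
    using algebra_mult_bilinear[OF assms(2)] D unfolding bilinear_op_def linear_map_def by simp
  then have bil: "bilinear_op K A (circ A)"
    by (simp add: bilinear_op_def)
  show ?thesis
  proof unfold_locales
    show "bilinear_op K A (circ A)" by (rule bil)
  next
    fix a b c assume abc: "a \<in> carrier A" "b \<in> carrier A" "c \<in> carrier A"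
    have assoc: "((x \<circ>\<^bsub>A\<^esub> y) \<circ>\<^bsub>A\<^esub> c) \<ominus>\<^bsub>A\<^esub> (x \<circ>\<^bsub>A\<^esub> (y \<circ>\<^bsub>A\<^esub> c))
        = (x \<otimes>\<^bsub>A\<^esub> y) \<otimes>\<^bsub>A\<^esub> ((D c \<otimes>\<^bsub>A\<^esub> D \<one>\<^bsub>A\<^esub>) \<ominus>\<^bsub>A\<^esub> D (D c))"
      if "x \<in> carrier A" "y \<in> carrier A" for x y
    proof -
      have cancel: "p \<ominus>\<^bsub>A\<^esub> ((p \<oplus>\<^bsub>A\<^esub> q) \<ominus>\<^bsub>A\<^esub> r) = r \<ominus>\<^bsub>A\<^esub> q"
        if "p \<in> carrier A" "q \<in> carrier A" "r \<in> carrier A" for p q r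
        using that
        by (simp add: a_minus_def A.minus_add A.a_assoc A.a_lcomm[of q "\<ominus>\<^bsub>A\<^esub> p"] A.r_neg2)
          (simp add: A.a_comm)
      have "x \<otimes>\<^bsub>A\<^esub> D (y \<otimes>\<^bsub>A\<^esub> D c) =
          ((x \<otimes>\<^bsub>A\<^esub> D y \<otimes>\<^bsub>A\<^esub> D c) \<oplus>\<^bsub>A\<^esub> (x \<otimes>\<^bsub>A\<^esub> y \<otimes>\<^bsub>A\<^esub> D (D c)))
            \<ominus>\<^bsub>A\<^esub> (x \<otimes>\<^bsub>A\<^esub> y \<otimes>\<^bsub>A\<^esub> (D c \<otimes>\<^bsub>A\<^esub> D \<one>\<^bsub>A\<^esub>))"
        using that abc
        by (simp add: leibniz a_minus_def A.r_distr A.r_minus A.m_assoc)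
      then have "((x \<circ>\<^bsub>A\<^esub> y) \<circ>\<^bsub>A\<^esub> c) \<ominus>\<^bsub>A\<^esub> (x \<circ>\<^bsub>A\<^esub> (y \<circ>\<^bsub>A\<^esub> c))
          = (x \<otimes>\<^bsub>A\<^esub> y \<otimes>\<^bsub>A\<^esub> (D c \<otimes>\<^bsub>A\<^esub> D \<one>\<^bsub>A\<^esub>)) \<ominus>\<^bsub>A\<^esub> (x \<otimes>\<^bsub>A\<^esub> y \<otimes>\<^bsub>A\<^esub> D (D c))"
        using cancel that abc by simp
      also have "\<dots> = (x \<otimes>\<^bsub>A\<^esub> y) \<otimes>\<^bsub>A\<^esub> ((D c \<otimes>\<^bsub>A\<^esub> D \<one>\<^bsub>A\<^esub>) \<ominus>\<^bsub>A\<^esub> D (D c))"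
        using that abc by (simp add: a_minus_def A.r_distr A.r_minus)
      finally show ?thesis .
    qed
    show "((a \<circ>\<^bsub>A\<^esub> b) \<circ>\<^bsub>A\<^esub> c) \<ominus>\<^bsub>A\<^esub> (a \<circ>\<^bsub>A\<^esub> (b \<circ>\<^bsub>A\<^esub> c))
        = ((b \<circ>\<^bsub>A\<^esub> a) \<circ>\<^bsub>A\<^esub> c) \<ominus>\<^bsub>A\<^esub> (b \<circ>\<^bsub>A\<^esub> (a \<circ>\<^bsub>A\<^esub> c))"
      using assoc[OF abc(1,2)] assoc[OF abc(2,1)] A.m_comm[OF abc(1,2)] by presburger
    show "(a \<circ>\<^bsub>A\<^esub> b) \<circ>\<^bsub>A\<^esub> c = (a \<circ>\<^bsub>A\<^esub> c) \<circ>\<^bsub>A\<^esub> b"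
      using abc by (simp add: A.m_ac)
    show "(a \<otimes>\<^bsub>A\<^esub> b) \<circ>\<^bsub>A\<^esub> c = a \<otimes>\<^bsub>A\<^esub> (b \<circ>\<^bsub>A\<^esub> c)"
      using abc by (simp add: A.m_assoc)
    show "c \<circ>\<^bsub>A\<^esub> (a \<otimes>\<^bsub>A\<^esub> b)
        = (((c \<circ>\<^bsub>A\<^esub> a) \<otimes>\<^bsub>A\<^esub> b) \<oplus>\<^bsub>A\<^esub> (a \<otimes>\<^bsub>A\<^esub> (c \<circ>\<^bsub>A\<^esub> b)))
            \<ominus>\<^bsub>A\<^esub> ((a \<otimes>\<^bsub>A\<^esub> b) \<otimes>\<^bsub>A\<^esub> (c \<circ>\<^bsub>A\<^esub> \<one>\<^bsub>A\<^esub>))"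
      using abc
      by (simp add: leibniz a_minus_def A.r_distr A.r_minus A.m_assoc A.m_lcomm[of c])
  qed
qed

text \<open>Hence \<open>\<circ>\<close> is determined by the product and the map \<open>b \<mapsto> 1 \<circ> b\<close>.\<close>

lemma circ_eq_mult_derivation:
  assumes "jacobi_novikov_poisson_algebra K A" "a \<in> carrier A" "b \<in> carrier A"
  shows "a \<otimes>\<^bsub>A\<^esub> (\<one>\<^bsub>A\<^esub> \<circ>\<^bsub>A\<^esub> b) = a \<circ>\<^bsub>A\<^esub> b"
proof -
  interpret A: jacobi_novikov_poisson_algebra K A by fact
  show ?thesis using A.mult_circ[of a "\<one>\<^bsub>A\<^esub>" b] assms(2,3) by simp
qed


section \<open>The tensor product of two Jacobi Novikov-Poisson algebras\<close>

lemma tensor_algebra_simps [simp]: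
  "carrier (tensor_algebra K A1 A2 m c) = carrier (tensor_module K A1 A2)"
  "mult (tensor_algebra K A1 A2 m c) = m"
  "one (tensor_algebra K A1 A2 m c) = pure_tensor K A1 A2 \<one>\<^bsub>A1\<^esub> \<one>\<^bsub>A2\<^esub>"
  "zero (tensor_algebra K A1 A2 m c) = zero (tensor_module K A1 A2)"
  "add (tensor_algebra K A1 A2 m c) = add (tensor_module K A1 A2)"
  "smult (tensor_algebra K A1 A2 m c) = smult (tensor_module K A1 A2)"
  "circ (tensor_algebra K A1 A2 m c) = c"
  by (simp_all add: tensor_algebra_def)

locale jnp_pair =
  A1: jacobi_novikov_poisson_algebra K A1 + A2: jacobi_novikov_poisson_algebra K A2
  for K :: "('k, 'm) ring_scheme"
    and A1 :: "('k, 'a, 'p) circ_module_scheme"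
    and A2 :: "('k, 'b, 'q) circ_module_scheme"

sublocale jnp_pair \<subseteq> module_pair K A1 A2
  by unfold_locales

context jnp_pair
begin

interpretation T: module K T by (rule module_tensor)

lemma tensor_mult_exists: "\<exists>m. is_tensor_mult K A1 A2 m"
  using tensor_op_exists[OF algebra_mult_bilinear[OF A1.algebra_axioms]
      algebra_mult_bilinear[OF A2.algebra_axioms]]
  unfolding is_tensor_mult_def .

lemma tensor_circ_exists: "\<exists>c. is_tensor_circ K A1 A2 c"
proof -
  obtain h1 where h1: "bilinear_op K T h1"
    "\<forall>a1 \<in> carrier A1. \<forall>b1 \<in> carrier A1. \<forall>a2 \<in> carrier A2. \<forall>b2 \<in> carrier A2.
      h1 (pt a1 a2) (pt b1 b2) = pt (a1 \<circ>\<^bsub>A1\<^esub> b1) (a2 \<otimes>\<^bsub>A2\<^esub> b2)"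
    using tensor_op_exists[OF A1.circ_bilinear algebra_mult_bilinear[OF A2.algebra_axioms]] by blast
  obtain h2 where h2: "bilinear_op K T h2"
    "\<forall>a1 \<in> carrier A1. \<forall>b1 \<in> carrier A1. \<forall>a2 \<in> carrier A2. \<forall>b2 \<in> carrier A2.
      h2 (pt a1 a2) (pt b1 b2) = pt (a1 \<otimes>\<^bsub>A1\<^esub> b1) (a2 \<circ>\<^bsub>A2\<^esub> b2)"
    using tensor_op_exists[OF algebra_mult_bilinear[OF A1.algebra_axioms] A2.circ_bilinear] by blast
  have "bilinear_op K T (\<lambda>x y. h1 x y \<oplus>\<^bsub>T\<^esub> h2 x y)"
    unfolding bilinear_op_iff_bilinear_map
    by (rule bilinear_map_plus[OF module_tensor])
      (simp_all add: h1(1) h2(1) flip: bilinear_op_iff_bilinear_map)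
  then show ?thesis
    unfolding is_tensor_circ_def using h1(2) h2(2)
    by (intro exI[of _ "\<lambda>x y. h1 x y \<oplus>\<^bsub>T\<^esub> h2 x y"]) simp
qed

lemma tensor_mult_unique:
  assumes "is_tensor_mult K A1 A2 m" "is_tensor_mult K A1 A2 m'"
    and "x \<in> carrier T" "y \<in> carrier T"
  shows "m x y = m' x y"
proof (rule bilinear_map_tensor_eq[OF _ _ _ assms(3,4)])
  show "bilinear_map K T T T m" "bilinear_map K T T T m'"
    using assms(1,2) by (simp_all add: is_tensor_mult_def bilinear_op_iff_bilinear_map)
qed (use assms(1,2) in \<open>simp add: is_tensor_mult_def\<close>)

lemma tensor_circ_unique:
  assumes "is_tensor_circ K A1 A2 c" "is_tensor_circ K A1 A2 c'"
    and "x \<in> carrier T" "y \<in> carrier T"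
  shows "c x y = c' x y"
proof (rule bilinear_map_tensor_eq[OF _ _ _ assms(3,4)])
  show "bilinear_map K T T T c" "bilinear_map K T T T c'"
    using assms(1,2) by (simp_all add: is_tensor_circ_def bilinear_op_iff_bilinear_map)
qed (use assms(1,2) in \<open>simp add: is_tensor_circ_def\<close>)

context
  fixes m
  assumes mult: "is_tensor_mult K A1 A2 m"
begin

lemma bilinear_mult: "bilinear_map K T T T m"
  using mult unfolding is_tensor_mult_def bilinear_op_iff_bilinear_map by blast

lemma mult_pure:
  "\<lbrakk>a1 \<in> carrier A1; a2 \<in> carrier A2; b1 \<in> carrier A1; b2 \<in> carrier A2\<rbrakk>
    \<Longrightarrow> m (pt a1 a2) (pt b1 b2) = pt (a1 \<otimes>\<^bsub>A1\<^esub> b1) (a2 \<otimes>\<^bsub>A2\<^esub> b2)"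
  using mult unfolding is_tensor_mult_def by blast

lemmas mult_closed = bilinear_map_closed[OF bilinear_mult]
lemmas mult_right = linear_mapD[OF bilinear_map_right[OF bilinear_mult]]
lemmas mult_left = linear_mapD[OF bilinear_map_left[OF bilinear_mult]]

lemma one_tensor_closed: "pt \<one>\<^bsub>A1\<^esub> \<one>\<^bsub>A2\<^esub> \<in> carrier T"
  by (rule pure_tensor_closed) simp_all

lemma mult_comm:
  assumes "X \<in> carrier T" "Y \<in> carrier T"
  shows "m X Y = m Y X"
  by (rule bilinear_map_tensor_eq[OF bilinear_mult bilinear_map_swap[OF bilinear_mult] _ assms])
    (simp add: mult_pure A1.m_comm A2.m_comm)

lemma mult_assoc:
  assumes x: "x \<in> carrier T" and y: "y \<in> carrier T" and z: "z \<in> carrier T"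
  shows "m (m x y) z = m x (m y z)"
proof (rule bilinear_map_tensor_eq[OF
      bilinear_map_linear_comp[OF bilinear_mult bilinear_map_left[OF bilinear_mult z]]
      bilinear_map_comp2[OF bilinear_mult linear_map_id bilinear_map_left[OF bilinear_mult z]] _ x y])
  fix a1 a2 b1 b2
  assume a: "a1 \<in> carrier A1" "a2 \<in> carrier A2" and b: "b1 \<in> carrier A1" "b2 \<in> carrier A2"
  note pa = pure_tensor_closed[OF a] and pb = pure_tensor_closed[OF b]
  show "m (m (pt a1 a2) (pt b1 b2)) z = m (pt a1 a2) (m (pt b1 b2) z)"
    by (rule linear_map_tensor_eq[OF bilinear_map_right[OF bilinear_mult mult_closed[OF pa pb]]
          linear_map_comp[OF bilinear_map_right[OF bilinear_mult pb]
            bilinear_map_right[OF bilinear_mult pa]] _ z])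
      (simp add: mult_pure a b A1.m_assoc A2.m_assoc)
qed

lemma mult_one:
  assumes X: "X \<in> carrier T"
  shows "m (pt \<one>\<^bsub>A1\<^esub> \<one>\<^bsub>A2\<^esub>) X = X"
  by (rule linear_map_tensor_eq[OF bilinear_map_right[OF bilinear_mult one_tensor_closed]
        linear_map_id _ X])
    (simp add: mult_pure)

lemma algebra_tensor: "algebra K (tensor_algebra K A1 A2 m c)"
proof -
  let ?A = "tensor_algebra K A1 A2 m c"
  have group: "abelian_group ?A"
  proof (rule abelian_groupI)
    fix x assume "x \<in> carrier ?A"
    then show "\<exists>y\<in>carrier ?A. y \<oplus>\<^bsub>?A\<^esub> x = \<zero>\<^bsub>?A\<^esub>"
      using T.M.l_neg T.M.a_inv_closed by (intro bexI[of _ "\<ominus>\<^bsub>T\<^esub> x"]) simp_all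
  qed (simp_all add: T.M.a_ac)
  have monoid: "comm_monoid ?A"
  proof (rule comm_monoidI)
    show "x \<otimes>\<^bsub>?A\<^esub> y \<otimes>\<^bsub>?A\<^esub> z = x \<otimes>\<^bsub>?A\<^esub> (y \<otimes>\<^bsub>?A\<^esub> z)"
      if "x \<in> carrier ?A" "y \<in> carrier ?A" "z \<in> carrier ?A" for x y z
      using mult_assoc that by simp
    show "x \<otimes>\<^bsub>?A\<^esub> y = y \<otimes>\<^bsub>?A\<^esub> x" if "x \<in> carrier ?A" "y \<in> carrier ?A" for x y
      using mult_comm that by simp
  qed (simp_all add: mult_closed one_tensor_closed mult_one)
  show ?thesis
  proof (rule algebraI)
    show "cring ?A"
      by (rule cringI[OF group monoid]) (simp add: mult_left(2))
  qed (simp_all add: A1.R_cring T.smult_l_distr T.smult_r_distr T.smult_assoc1 mult_left(3))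
qed

context
  fixes c
  assumes circ: "is_tensor_circ K A1 A2 c"
begin

abbreviation (input) "D \<equiv> c (pt \<one>\<^bsub>A1\<^esub> \<one>\<^bsub>A2\<^esub>)"
abbreviation (input) "D1 a \<equiv> \<one>\<^bsub>A1\<^esub> \<circ>\<^bsub>A1\<^esub> a"
abbreviation (input) "D2 a \<equiv> \<one>\<^bsub>A2\<^esub> \<circ>\<^bsub>A2\<^esub> a"

lemma bilinear_circ: "bilinear_map K T T T c"
  using circ unfolding is_tensor_circ_def bilinear_op_iff_bilinear_map by blast

lemma circ_pure:
  "\<lbrakk>a1 \<in> carrier A1; a2 \<in> carrier A2; b1 \<in> carrier A1; b2 \<in> carrier A2\<rbrakk>
    \<Longrightarrow> c (pt a1 a2) (pt b1 b2)
      = pt (a1 \<circ>\<^bsub>A1\<^esub> b1) (a2 \<otimes>\<^bsub>A2\<^esub> b2) \<oplus>\<^bsub>T\<^esub> pt (a1 \<otimes>\<^bsub>A1\<^esub> b1) (a2 \<circ>\<^bsub>A2\<^esub> b2)"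
  using circ unfolding is_tensor_circ_def by blast

lemma linear_derivation: "linear_map K T T D"
  by (rule bilinear_map_right[OF bilinear_circ one_tensor_closed])

text \<open>That is, \<open>D = D\<^sub>1 \<otimes> id + id \<otimes> D\<^sub>2\<close>.\<close>

lemma derivation_pure:
  "\<lbrakk>a1 \<in> carrier A1; a2 \<in> carrier A2\<rbrakk> \<Longrightarrow> D (pt a1 a2) = pt (D1 a1) a2 \<oplus>\<^bsub>T\<^esub> pt a1 (D2 a2)"
  by (simp add: circ_pure)

lemma circ_closed1: "\<lbrakk>a \<in> carrier A1; b \<in> carrier A1\<rbrakk> \<Longrightarrow> a \<circ>\<^bsub>A1\<^esub> b \<in> carrier A1"
  using A1.circ_bilinear unfolding bilinear_op_def by blast

lemma circ_closed2: "\<lbrakk>a \<in> carrier A2; b \<in> carrier A2\<rbrakk> \<Longrightarrow> a \<circ>\<^bsub>A2\<^esub> b \<in> carrier A2"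
  using A2.circ_bilinear unfolding bilinear_op_def by blast

lemma circ_eq_mult_derivation_tensor:
  assumes "X \<in> carrier T" "Y \<in> carrier T"
  shows "c X Y = m X (D Y)"
  by (rule bilinear_map_tensor_eq[OF bilinear_circ
        bilinear_map_comp2[OF bilinear_mult linear_map_id linear_derivation] _ assms])
    (simp add: circ_pure mult_pure mult_right(2) pure_tensor_closed circ_closed1 circ_closed2
      circ_eq_mult_derivation[OF A1.jacobi_novikov_poisson_algebra_axioms]
      circ_eq_mult_derivation[OF A2.jacobi_novikov_poisson_algebra_axioms])

text \<open>Both sides are bilinear in \<open>X\<close> and \<open>Y\<close>.  On pure tensors, the twisted Leibniz rules for \<open>D\<^sub>1\<close> and
  \<open>D\<^sub>2\<close> give three terms each (\<open>p\<close>, \<open>q\<close>, \<open>r\<close>, indexed by the factor that is differentiated), and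
  corresponding terms add up to the three terms on the right-hand side.\<close>

lemma leibniz_tensor:
  assumes X: "X \<in> carrier T" and Y: "Y \<in> carrier T"
  shows "D (m X Y) = (m (D X) Y \<oplus>\<^bsub>T\<^esub> m X (D Y)) \<ominus>\<^bsub>T\<^esub> m (m X Y) (D (pt \<one>\<^bsub>A1\<^esub> \<one>\<^bsub>A2\<^esub>))"
proof -
  let ?d = "D (pt \<one>\<^bsub>A1\<^esub> \<one>\<^bsub>A2\<^esub>)"
  have d: "?d \<in> carrier T" by (rule linear_map_closed[OF linear_derivation one_tensor_closed])
  have lhs: "bilinear_map K T T T (\<lambda>X Y. D (m X Y))"
    by (rule bilinear_map_linear_comp[OF bilinear_mult linear_derivation])
  have rhs: "bilinear_map K T T T (\<lambda>X Y. (m (D X) Y \<oplus>\<^bsub>T\<^esub> m X (D Y)) \<ominus>\<^bsub>T\<^esub> m (m X Y) ?d)"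
    by (intro bilinear_map_diff[OF module_tensor] bilinear_map_plus[OF module_tensor]
        bilinear_map_comp2[OF bilinear_mult linear_derivation linear_map_id]
        bilinear_map_comp2[OF bilinear_mult linear_map_id linear_derivation]
        bilinear_map_linear_comp[OF bilinear_mult bilinear_map_left[OF bilinear_mult d]])
  show ?thesis
  proof (rule bilinear_map_tensor_eq[OF lhs rhs _ X Y])
    fix a1 a2 b1 b2
    assume a: "a1 \<in> carrier A1" "a2 \<in> carrier A2" and b: "b1 \<in> carrier A1" "b2 \<in> carrier A2"
    note [simp] = a b pure_tensor_closed circ_closed1 circ_closed2
    note left = bilinear_map_left[OF bilinear_map_pure_tensor]
      and right = bilinear_map_right[OF bilinear_map_pure_tensor]
    let ?p1 = "pt (D1 a1 \<otimes>\<^bsub>A1\<^esub> b1) (a2 \<otimes>\<^bsub>A2\<^esub> b2)"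
    let ?q1 = "pt (a1 \<otimes>\<^bsub>A1\<^esub> D1 b1) (a2 \<otimes>\<^bsub>A2\<^esub> b2)"
    let ?r1 = "pt ((a1 \<otimes>\<^bsub>A1\<^esub> b1) \<otimes>\<^bsub>A1\<^esub> D1 \<one>\<^bsub>A1\<^esub>) (a2 \<otimes>\<^bsub>A2\<^esub> b2)"
    let ?p2 = "pt (a1 \<otimes>\<^bsub>A1\<^esub> b1) (D2 a2 \<otimes>\<^bsub>A2\<^esub> b2)"
    let ?q2 = "pt (a1 \<otimes>\<^bsub>A1\<^esub> b1) (a2 \<otimes>\<^bsub>A2\<^esub> D2 b2)"
    let ?r2 = "pt (a1 \<otimes>\<^bsub>A1\<^esub> b1) ((a2 \<otimes>\<^bsub>A2\<^esub> b2) \<otimes>\<^bsub>A2\<^esub> D2 \<one>\<^bsub>A2\<^esub>)"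
    have e1: "pt (D1 (a1 \<otimes>\<^bsub>A1\<^esub> b1)) (a2 \<otimes>\<^bsub>A2\<^esub> b2) = (?p1 \<oplus>\<^bsub>T\<^esub> ?q1) \<ominus>\<^bsub>T\<^esub> ?r1"
      by (simp add: A1.circ_mult linear_map_minus[OF A1.module module_tensor left]
          linear_map_add[OF left])
    have e2: "pt (a1 \<otimes>\<^bsub>A1\<^esub> b1) (D2 (a2 \<otimes>\<^bsub>A2\<^esub> b2)) = (?p2 \<oplus>\<^bsub>T\<^esub> ?q2) \<ominus>\<^bsub>T\<^esub> ?r2"
      by (simp add: A2.circ_mult linear_map_minus[OF A2.module module_tensor right]
          linear_map_add[OF right])
    have "D (m (pt a1 a2) (pt b1 b2)) = ((?p1 \<oplus>\<^bsub>T\<^esub> ?q1) \<ominus>\<^bsub>T\<^esub> ?r1) \<oplus>\<^bsub>T\<^esub> ((?p2 \<oplus>\<^bsub>T\<^esub> ?q2) \<ominus>\<^bsub>T\<^esub> ?r2)"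
      by (simp add: mult_pure derivation_pure e1 e2)
    also have "\<dots> = ((?p1 \<oplus>\<^bsub>T\<^esub> ?p2) \<oplus>\<^bsub>T\<^esub> (?q1 \<oplus>\<^bsub>T\<^esub> ?q2)) \<ominus>\<^bsub>T\<^esub> (?r1 \<oplus>\<^bsub>T\<^esub> ?r2)"
      by (simp add: a_minus_def T.M.minus_add T.M.a_ac)
    also have "?p1 \<oplus>\<^bsub>T\<^esub> ?p2 = m (D (pt a1 a2)) (pt b1 b2)"
      by (simp add: derivation_pure mult_left(2) mult_pure)
    also have "?q1 \<oplus>\<^bsub>T\<^esub> ?q2 = m (pt a1 a2) (D (pt b1 b2))"
      by (simp add: derivation_pure mult_right(2) mult_pure)
    also have "?r1 \<oplus>\<^bsub>T\<^esub> ?r2 = m (m (pt a1 a2) (pt b1 b2)) ?d"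
      by (simp add: derivation_pure mult_right(2) mult_pure)
    finally show "D (m (pt a1 a2) (pt b1 b2))
      = (m (D (pt a1 a2)) (pt b1 b2) \<oplus>\<^bsub>T\<^esub> m (pt a1 a2) (D (pt b1 b2)))
          \<ominus>\<^bsub>T\<^esub> m (m (pt a1 a2) (pt b1 b2)) ?d" .
  qed
qed

lemma jacobi_novikov_poisson_algebra_tensor:
  "jacobi_novikov_poisson_algebra K (tensor_algebra K A1 A2 m c)"
proof (rule jacobi_novikov_poisson_algebraI_derivation[where D = D])
  show "field K" by (rule A1.K.field_axioms)
  show "algebra K (tensor_algebra K A1 A2 m c)" by (rule algebra_tensor)
  show "linear_map K (tensor_algebra K A1 A2 m c) (tensor_algebra K A1 A2 m c) D"
    using linear_derivation unfolding linear_map_def by simp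
  \<comment> \<open>Subtraction is unfolded down to the description of additive inverses, because it refers to the
    underlying record, and the records of \<open>tensor_algebra\<close> and \<open>tensor_module\<close> differ.\<close>
qed (simp_all add: leibniz_tensor circ_eq_mult_derivation_tensor a_minus_def a_inv_def m_inv_def)

end

end

end

theorem proposition2p14:
  fixes K :: "('k, 'm) ring_scheme"
    and A1 :: "('k, 'a, 'p) circ_module_scheme"
    and A2 :: "('k, 'b, 'q) circ_module_scheme"
  assumes "field K"
    and "jacobi_novikov_poisson_algebra K A1"
    and "jacobi_novikov_poisson_algebra K A2"
  shows "(\<exists>m. is_tensor_mult K A1 A2 m) \<and>
    (\<exists>c. is_tensor_circ K A1 A2 c) \<and>
    (\<forall>m m'. is_tensor_mult K A1 A2 m \<and> is_tensor_mult K A1 A2 m' \<longrightarrow>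
      (\<forall>x \<in> carrier (tensor_module K A1 A2). \<forall>y \<in> carrier (tensor_module K A1 A2). m x y = m' x y)) \<and>
    (\<forall>c c'. is_tensor_circ K A1 A2 c \<and> is_tensor_circ K A1 A2 c' \<longrightarrow>
      (\<forall>x \<in> carrier (tensor_module K A1 A2). \<forall>y \<in> carrier (tensor_module K A1 A2). c x y = c' x y)) \<and>
    (\<forall>m c. is_tensor_mult K A1 A2 m \<and> is_tensor_circ K A1 A2 c \<longrightarrow>
      jacobi_novikov_poisson_algebra K (tensor_algebra K A1 A2 m c))"
proof -
  interpret jnp_pair K A1 A2
    by (rule jnp_pair.intro[OF assms(2,3)])
  show ?thesis
  proof (intro conjI allI impI ballI)
    show "\<exists>m. is_tensor_mult K A1 A2 m" by (rule tensor_mult_exists)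
    show "\<exists>c. is_tensor_circ K A1 A2 c" by (rule tensor_circ_exists)
  next
    fix m m' x y
    assume "is_tensor_mult K A1 A2 m \<and> is_tensor_mult K A1 A2 m'"
      and "x \<in> carrier (tensor_module K A1 A2)" "y \<in> carrier (tensor_module K A1 A2)"
    then show "m x y = m' x y" by (elim conjE) (rule tensor_mult_unique)
  next
    fix c c' x y
    assume "is_tensor_circ K A1 A2 c \<and> is_tensor_circ K A1 A2 c'"
      and "x \<in> carrier (tensor_module K A1 A2)" "y \<in> carrier (tensor_module K A1 A2)"
    then show "c x y = c' x y" by (elim conjE) (rule tensor_circ_unique)
  next
    fix m c
    assume "is_tensor_mult K A1 A2 m \<and> is_tensor_circ K A1 A2 c"
    then show "jacobi_novikov_poisson_algebra K (tensor_algebra K A1 A2 m c)"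
      by (elim conjE) (rule jacobi_novikov_poisson_algebra_tensor)
  qed
qed

end
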